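(* Let $\hat u$ be the solution on $[0,T]$, assumed smooth on $\mathbb{T}^n\times[0,T]$, of the weak problem $$\langle \hat u_t,\psi\rangle+a(\hat u,\psi)+\langle F(\hat u),\psi\rangle=\langle-\vec P\cdot\vec V,\psi\rangle\quad\forall\psi\in H,\qquad \hat u(\cdot,0)=0,$$ and let $\{\hat U_k\}_{k=0}^m\subset S^r$ be its backward Euler and POD-based Galerkin approximation, i.e. $\hat U_0=0$ and, for $k=1,\dots,m$, $$\Big\langle \frac{\hat U_k-\hat U_{k-1}}{\Delta t},\psi\Big\rangle+a(\hat U_k,\psi)+\langle F(\hat U_k),\psi\rangle=\langle-\vec P\cdot\vec V,\psi\rangle\quad\forall\psi\in S^r .$$ Then for sufficiently small $\Delta t$ there exists a constant $C>0$, depending on $\hat u$, $d$, $S_l$, $\vec V$, $\vec P$ and $T$ but independent of $r$, $\Delta t$ and $m$, such that $$\frac1m\sum_{k=1}^m\big\|\hat U_k-\hat u(t_k)\big\|_{L^2}^2\le C\Big((\Delta t)^2+\sum_{l=r+1}^m\lambda_l\Big).$$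
   Context: Setting. $\mathbb{T}^n=[0,1]^n$ with periodic boundary conditions; $d>0$ (Markstein number) and $S_l>0$ (laminar flame speed) are constants; $\vec P\in\mathbb{R}^n$ is a unit vector. The velocity field $\vec V(\vec x,t)$ is spatially periodic, $C^1$ in $\vec x$, $C^0$ in $t$, divergence-free in $\vec x$ ($\nabla_{\vec x}\cdot\vec V(\vec x,t)=0$ for all $t$), mean-zero in space in the sense that $\int_{\mathbb{T}^n}\vec V\cdot\vec P\,d\vec x=0$, and uniformly bounded, $\|\vec V\|_\infty\le A$. Spaces. $\langle\cdot,\cdot\rangle$ is the standard inner product of $L^2=L^2(\mathbb{T}^n)$, with norm $\|\cdot\|_{L^2}$. $H^1_{per}(\mathbb{T}^n)$ is the periodic Sobolev space, and $H\subset H^1_{per}(\mathbb{T}^n)$ is the closed subspace of mean-free functions ($\int_{\mathbb{T}^n}u\,d\vec x=0$), with the standard $H^1$ inner product $\langle u,v\rangle_H=\int_{\mathbb{T}^n}(uv+\nabla u\cdot\nabla v)\,d\vec x$ and norm $\|\cdot\|_H$. Forms. For $u,v\in H$, $$a(u,v)=\int_{\mathbb{T}^n}\big[(\vec V\cdot\nabla u)v+dS_l\,\nabla u\cdot\nabla v\big]d\vec x,\qquad F(u)=S_l|\vec P+\nabla u|-\int_{\mathbb{T}^n}S_l|\vec P+\nabla u|\,d\vec x .$$ If $\vec V$ depends on time, it is evaluated at time $t$ in the weak problem and at time $t_k$ in the $k$-th step of the backward Euler scheme. Origin. $\hat u$ is the mean-free part of the solution $u$ of the periodic problem $u_t+\vec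 V\cdot(\vec P+\nabla u)+S_l|\vec P+\nabla u|=dS_l\Delta u$, $u(\cdot,0)=0$. Time grid and POD basis. $t_k=k\Delta t$, $\Delta t=T/m$, $k=0,\dots,m$. The $2m+1$ snapshots are $\hat u(t_0),\dots,\hat u(t_m),\bar\partial\hat u(t_1),\dots,\bar\partial\hat u(t_m)$, where $\bar\partial\hat u(t_i)=(\hat u(t_i)-\hat u(t_{i-1}))/\Delta t$. Denote them $y_1,\dots,y_{2m+1}$. The snapshot correlation matrix is $K_{ij}=\frac1{2m+1}\langle y_i,y_j\rangle_H$, with eigenvalues $\lambda_1\ge\lambda_2\ge\cdots\ge0$ (so $\lambda_l$ is the $l$-th largest eigenvalue of $K$) and corresponding orthonormal eigenvectors $v_k$. The POD basis is $\{\psi_1,\dots,\psi_r\}$, where $\psi_k$ is the $H$-normalization of $\sum_j (v_k)_j y_j$, for $1\le k\le r$ with $\lambda_k>0$. It is an $H$-orthonormal system minimizing $$\frac1{2m+1}\sum_{i=0}^m\Big\|\hat u(t_i)-\sum_{j=1}^r\langle\hat u(t_i),\psi_j\rangle_H\psi_j\Big\|_H^2+\frac1{2m+1}\sum_{i=1}^m\Big\|\bar\partial\hat u(t_i)-\sum_{j=1}^r\langle\bar\partial\hat u(t_i),\psi_j\rangle_H\psi_j\Big\|_H^2,$$ and $S^r=\mathrm{span}\{\psi_1,\dots,\psi_r\}\subset H$. *)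

theory Defs
  imports "HOL-Analysis.Analysis" "Jordan_Normal_Form.Char_Poly"
begin

text \<open>Jordan_Normal_Form is needed only for the eigenvectors of the snapshot correlation matrix, whose
  size varies with the time grid. Below, \<open>$\<close> and \<open>\<bullet>\<close> are those of HOL-Analysis.\<close>

no_notation vec_index (infixl \<open>$\<close> 100)
no_notation scalar_prod (infix \<open>\<bullet>\<close> 70)

section \<open>Functions on the torus\<close>

text \<open>A function on the torus is a function on the whole space that is periodic under integer
  translations; it is integrated over the unit cube.\<close>

abbreviation torus :: "(real ^ 'n) measure" where
  "torus \<equiv> lebesgue_on (cbox 0 1)"

definition periodic :: "(real ^ 'n \<Rightarrow> 'b) \<Rightarrow> bool" where
  "periodic f \<longleftrightarrow> (\<forall>x z. (\<forall>i. z $ i \<in> \<int>) \<longrightarrow> f (x + z) = f x)"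

text \<open>\<open>Ck_on k S f\<close>: all partial derivatives of order at most \<open>k\<close> exist on \<open>S\<close>, taken within \<open>S\<close>,
  and are continuous there. It is used only for \<open>S\<close> on which derivatives within \<open>S\<close> are unique
  (the whole space, and the whole space times a nondegenerate compact time interval).\<close>

fun Ck_on :: "nat \<Rightarrow> 'a::euclidean_space set \<Rightarrow> ('a \<Rightarrow> real) \<Rightarrow> bool" where
  "Ck_on 0 S f \<longleftrightarrow> continuous_on S f"
| "Ck_on (Suc k) S f \<longleftrightarrow>
     (\<exists>g. (\<forall>x\<in>S. (f has_derivative (\<lambda>h. g x \<bullet> h)) (at x within S)) \<and>
          (\<forall>b\<in>Basis. Ck_on k S (\<lambda>x. g x \<bullet> b)))"

definition smooth_on :: "'a::euclidean_space set \<Rightarrow> ('a \<Rightarrow> real) \<Rightarrow> bool" where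
  "smooth_on S f \<longleftrightarrow> (\<forall>k. Ck_on k S f)"

definition divergence :: "(real ^ 'n \<Rightarrow> real ^ 'n) \<Rightarrow> real ^ 'n \<Rightarrow> real" where
  "divergence v x = (\<Sum>i\<in>UNIV. frechet_derivative v (at x) (axis i 1) $ i)"

definition L2_inner :: "(real ^ 'n \<Rightarrow> real) \<Rightarrow> (real ^ 'n \<Rightarrow> real) \<Rightarrow> real" where
  "L2_inner u v = (LINT x|torus. u x * v x)"

definition L2_norm :: "(real ^ 'n \<Rightarrow> real) \<Rightarrow> real" where
  "L2_norm u = sqrt (L2_inner u u)"

section \<open>Periodic Sobolev space\<close>

text \<open>Elements of the Sobolev spaces are represented by functions, not by classes modulo
  almost-everywhere equality.\<close>

definition has_weak_grad :: "(real ^ 'n \<Rightarrow> real) \<Rightarrow> (real ^ 'n \<Rightarrow> real ^ 'n) \<Rightarrow> bool" where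
  "has_weak_grad u g \<longleftrightarrow>
     g \<in> borel_measurable torus \<and> integrable torus (\<lambda>x. (norm (g x))\<^sup>2) \<and>
     (\<forall>\<phi>. smooth_on UNIV \<phi> \<and> periodic \<phi> \<longrightarrow>
        (\<forall>i. (LINT x|torus. u x * frechet_derivative \<phi> (at x) (axis i 1)) =
             - (LINT x|torus. g x $ i * \<phi> x)))"

text \<open>Determined only up to a null set of the unit cube, and arbitrary outside it.\<close>

definition weak_grad :: "(real ^ 'n \<Rightarrow> real) \<Rightarrow> real ^ 'n \<Rightarrow> real ^ 'n" where
  "weak_grad u = (SOME g. has_weak_grad u g)"

definition H1_per :: "(real ^ 'n \<Rightarrow> real) set" where
  "H1_per = {u. periodic u \<and> u \<in> borel_measurable torus \<and> integrable torus (\<lambda>x. (u x)\<^sup>2) \<and>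
                (\<exists>g. has_weak_grad u g)}"

definition H_space :: "(real ^ 'n \<Rightarrow> real) set" where
  "H_space = {u \<in> H1_per. (LINT x|torus. u x) = 0}"

definition H_inner :: "(real ^ 'n \<Rightarrow> real) \<Rightarrow> (real ^ 'n \<Rightarrow> real) \<Rightarrow> real" where
  "H_inner u v = (LINT x|torus. u x * v x + weak_grad u x \<bullet> weak_grad v x)"

definition H_norm :: "(real ^ 'n \<Rightarrow> real) \<Rightarrow> real" where
  "H_norm u = sqrt (H_inner u u)"

section \<open>The weak problem\<close>

definition admissible_velocity ::
    "real ^ 'n \<Rightarrow> real \<Rightarrow> real \<Rightarrow> (real \<Rightarrow> real ^ 'n \<Rightarrow> real ^ 'n) \<Rightarrow> bool" where
  "admissible_velocity P A T V \<longleftrightarrow>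
     (\<forall>t\<in>{0..T}. periodic (V t)) \<and>
     (\<forall>t\<in>{0..T}. \<forall>i. Ck_on 1 UNIV (\<lambda>x. V t x $ i)) \<and>
     (\<forall>x. continuous_on {0..T} (\<lambda>t. V t x)) \<and>
     (\<forall>t\<in>{0..T}. \<forall>x. divergence (V t) x = 0) \<and>
     (\<forall>t\<in>{0..T}. (LINT x|torus. V t x \<bullet> P) = 0) \<and>
     (\<forall>t\<in>{0..T}. \<forall>x. norm (V t x) \<le> A)"

text \<open>In the two forms below, \<open>V\<close> is the velocity field at a fixed time.\<close>

definition form_a ::
    "real \<Rightarrow> real \<Rightarrow> (real ^ 'n \<Rightarrow> real ^ 'n) \<Rightarrow> (real ^ 'n \<Rightarrow> real) \<Rightarrow> (real ^ 'n \<Rightarrow> real) \<Rightarrow> real" where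
  "form_a d Sl V u v =
     (LINT x|torus. (V x \<bullet> weak_grad u x) * v x + d * Sl * (weak_grad u x \<bullet> weak_grad v x))"

definition form_F :: "real \<Rightarrow> real ^ 'n \<Rightarrow> (real ^ 'n \<Rightarrow> real) \<Rightarrow> real ^ 'n \<Rightarrow> real" where
  "form_F Sl P u x =
     Sl * norm (P + weak_grad u x) - (LINT y|torus. Sl * norm (P + weak_grad u y))"

definition weak_solution ::
    "real \<Rightarrow> real \<Rightarrow> real ^ 'n \<Rightarrow> (real \<Rightarrow> real ^ 'n \<Rightarrow> real ^ 'n) \<Rightarrow> real \<Rightarrow>
     (real \<Rightarrow> real ^ 'n \<Rightarrow> real) \<Rightarrow> bool" where
  "weak_solution d Sl P V T u \<longleftrightarrow>
     (\<forall>t\<in>{0..T}. u t \<in> H_space) \<and>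
     u 0 = (\<lambda>x. 0) \<and>
     (\<forall>t\<in>{0..T}. \<forall>\<psi>\<in>H_space.
        L2_inner (\<lambda>x. vector_derivative (\<lambda>s. u s x) (at t within {0..T})) \<psi>
          + form_a d Sl (V t) (u t) \<psi> + L2_inner (form_F Sl P (u t)) \<psi>
        = L2_inner (\<lambda>x. - (P \<bullet> V t x)) \<psi>)"

section \<open>Snapshots and POD\<close>

definition grid :: "real \<Rightarrow> nat \<Rightarrow> nat \<Rightarrow> real" where
  "grid T m k = real k * (T / real m)"

text \<open>The snapshots are numbered from \<open>0\<close> to \<open>2 * m\<close>: first the values at the grid points
  \<open>0, \<dots>, m\<close>, then the backward difference quotients at the grid points \<open>1, \<dots>, m\<close>.\<close>

definition snapshot ::
    "real \<Rightarrow> nat \<Rightarrow> (real \<Rightarrow> real ^ 'n \<Rightarrow> real) \<Rightarrow> nat \<Rightarrow> real ^ 'n \<Rightarrow> real" where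
  "snapshot T m u j =
     (if j \<le> m then u (grid T m j)
      else (\<lambda>x. (u (grid T m (j - m)) x - u (grid T m (j - m - 1)) x) / (T / real m)))"

definition corr_matrix :: "nat \<Rightarrow> (nat \<Rightarrow> real ^ 'n \<Rightarrow> real) \<Rightarrow> real Matrix.mat" where
  "corr_matrix N y = Matrix.mat N N (\<lambda>(i, j). 1 / real N * H_inner (y i) (y j))"

text \<open>\<open>\<mu> 1 \<ge> \<dots> \<ge> \<mu> N\<close> are the eigenvalues of the symmetric \<open>N \<times> N\<close> matrix \<open>K\<close>, with multiplicity,
  and \<open>v 1, \<dots>, v N\<close> corresponding orthonormal eigenvectors. The values of \<open>\<mu>\<close> and \<open>v\<close> at other
  indices are irrelevant.\<close>

definition sorted_eigensystem ::
    "nat \<Rightarrow> real Matrix.mat \<Rightarrow> (nat \<Rightarrow> real) \<Rightarrow> (nat \<Rightarrow> real Matrix.vec) \<Rightarrow> bool" where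
  "sorted_eigensystem N K \<mu> v \<longleftrightarrow>
     (\<forall>k\<in>{1..N}. eigenvector K (v k) (\<mu> k)) \<and>
     (\<forall>j\<in>{1..N}. \<forall>k\<in>{1..N}. scalar_prod (v j) (v k) = (if j = k then 1 else 0)) \<and>
     (\<forall>j\<in>{1..N}. \<forall>k\<in>{1..N}. j \<le> k \<longrightarrow> \<mu> k \<le> \<mu> j)"

definition pod_mode ::
    "nat \<Rightarrow> (nat \<Rightarrow> real ^ 'n \<Rightarrow> real) \<Rightarrow> real Matrix.vec \<Rightarrow> real ^ 'n \<Rightarrow> real" where
  "pod_mode N y w =
     (let f = (\<lambda>x. \<Sum>j<N. vec_index w j * y j x) in (\<lambda>x. f x / H_norm f))"

text \<open>If fewer than \<open>r\<close> eigenvalues are positive, only the modes of the positive ones are used.\<close>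

definition pod_space ::
    "nat \<Rightarrow> (nat \<Rightarrow> real ^ 'n \<Rightarrow> real) \<Rightarrow> (nat \<Rightarrow> real) \<Rightarrow> (nat \<Rightarrow> real Matrix.vec) \<Rightarrow> nat \<Rightarrow>
     (real ^ 'n \<Rightarrow> real) set" where
  "pod_space N y \<mu> v r =
     {u. \<exists>c. u = (\<lambda>x. \<Sum>k\<in>{k\<in>{1..r}. \<mu> k > 0}. c k * pod_mode N y (v k) x)}"

definition backward_euler_galerkin ::
    "real \<Rightarrow> real \<Rightarrow> real ^ 'n \<Rightarrow> (real \<Rightarrow> real ^ 'n \<Rightarrow> real ^ 'n) \<Rightarrow> real \<Rightarrow> nat \<Rightarrow>
     (real ^ 'n \<Rightarrow> real) set \<Rightarrow> (nat \<Rightarrow> real ^ 'n \<Rightarrow> real) \<Rightarrow> bool" where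
  "backward_euler_galerkin d Sl P V T m S U \<longleftrightarrow>
     (\<forall>k\<in>{0..m}. U k \<in> S) \<and>
     U 0 = (\<lambda>x. 0) \<and>
     (\<forall>k\<in>{1..m}. \<forall>\<psi>\<in>S.
        L2_inner (\<lambda>x. (U k x - U (k - 1) x) / (T / real m)) \<psi>
          + form_a d Sl (V (grid T m k)) (U k) \<psi> + L2_inner (form_F Sl P (U k)) \<psi>
        = L2_inner (\<lambda>x. - (P \<bullet> V (grid T m k) x)) \<psi>)"

end

theory Submission
  imports Defs "HOL-Real_Asymp.Real_Asymp"
begin

text \<open>
  The error at time \<open>t k\<close> is split as \<open>U k - u (t k) = \<theta> k - \<rho> k\<close>, where \<open>w k\<close> is the \<open>H\<close>-orthogonal projection
  of \<open>u (t k)\<close> onto the POD space, \<open>\<rho> k = u (t k) - w k\<close> and \<open>\<theta> k = U k - w k\<close>. Since the backward difference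
  quotients are themselves snapshots, the POD controls the average of \<open>\<rho> k\<close> and of the difference quotient
  of \<open>\<rho>\<close> in the norm of \<open>H\<close> by the discarded eigenvalues (\<open>pod_proj_error\<close>). All snapshots are combinations of
  the \<open>m\<close> functions \<open>u (t 1), \<dots>, u (t m)\<close>, because \<open>u 0 = 0\<close>; hence the eigenvalues beyond the \<open>m\<close>-th vanish
  (\<open>eigenvalue_zero_beyond_rank\<close>) and the sum of the discarded ones may stop at \<open>m\<close>.

  The function \<open>\<theta> k\<close> lies in the POD space and is mean-free, so both weak equations may be tested with it. In
  their difference the average in \<open>F\<close> drops out, the nonlinearity is Lipschitz in the gradient, and all
  gradients of \<open>\<theta> k\<close> are absorbed into the diffusion term by Young's inequality (\<open>energy_step\<close>). The transport
  term is estimated by the bound on the velocity. What remains is a recursion for the squared norm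
  of \<open>\<theta> k\<close>, driven by \<open>\<rho>\<close>, its difference quotient and the first-order consistency error, which
  \<open>discrete_gronwall\<close> solves.

  To carry this out, weak gradients have to be computed. All functions involved are continuously differentiable
  and periodic. Their classical gradient is a weak gradient by integration by parts on the torus
  (\<open>C1_per_has_weak_grad\<close>), and weak gradients are unique almost everywhere (\<open>has_weak_grad_unique\<close>) because
  indicators of boxes are bounded pointwise limits of smooth periodic functions.
\<close>

section \<open>Smooth functions and test functions\<close>

lemma Ck_on_continuous: "Ck_on k S f \<Longrightarrow> continuous_on S f"
proof (cases k)
  case (Suc j)
  assume "Ck_on k S f"
  then obtain g where "\<forall>x\<in>S. (f has_derivative (\<lambda>h. g x \<bullet> h)) (at x within S)"
    using Suc by auto
  then show ?thesis
    by (meson differentiable_imp_continuous_on differentiable_on_def differentiable_def)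
qed simp

lemma Ck_on_Suc_imp: "Ck_on (Suc k) S f \<Longrightarrow> Ck_on k S f"
proof (induction k arbitrary: f)
  case 0
  then show ?case using Ck_on_continuous by (metis Ck_on.simps(1))
next
  case (Suc k)
  then obtain g where "\<forall>x\<in>S. (f has_derivative (\<lambda>h. g x \<bullet> h)) (at x within S)"
    "\<forall>b\<in>Basis. Ck_on (Suc k) S (\<lambda>x. g x \<bullet> b)" by (metis Ck_on.simps(2))
  then show ?case using Suc.IH by auto
qed

lemma Ck_on_const: "Ck_on k S (\<lambda>x. c)"
proof (induction k arbitrary: c)
  case (Suc k)
  show ?case
    using Suc[of 0] by (auto intro!: exI[of _ "\<lambda>x. 0"] simp: inner_zero_left[abs_def])
qed simp

lemma Ck_on_add: "Ck_on k S f \<Longrightarrow> Ck_on k S g \<Longrightarrow> Ck_on k S (\<lambda>x. f x + g x)"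
proof (induction k arbitrary: f g)
  case (Suc k)
  then obtain f' g' where
    "\<forall>x\<in>S. (f has_derivative (\<lambda>h. f' x \<bullet> h)) (at x within S)"
    "\<forall>b\<in>Basis. Ck_on k S (\<lambda>x. f' x \<bullet> b)"
    "\<forall>x\<in>S. (g has_derivative (\<lambda>h. g' x \<bullet> h)) (at x within S)"
    "\<forall>b\<in>Basis. Ck_on k S (\<lambda>x. g' x \<bullet> b)" by auto
  then show ?case
    by (auto intro!: exI[of _ "\<lambda>x. f' x + g' x"] derivative_eq_intros Suc.IH
        simp: inner_add_left)
qed (auto intro!: continuous_intros)

lemma Ck_on_mult: "Ck_on k S f \<Longrightarrow> Ck_on k S g \<Longrightarrow> Ck_on k S (\<lambda>x. f x * g x)"
proof (induction k arbitrary: f g)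
  case (Suc k)
  note fg = Suc.prems
  then obtain f' g' where
    d: "\<forall>x\<in>S. (f has_derivative (\<lambda>h. f' x \<bullet> h)) (at x within S)"
    "\<forall>b\<in>Basis. Ck_on k S (\<lambda>x. f' x \<bullet> b)"
    "\<forall>x\<in>S. (g has_derivative (\<lambda>h. g' x \<bullet> h)) (at x within S)"
    "\<forall>b\<in>Basis. Ck_on k S (\<lambda>x. g' x \<bullet> b)" by auto
  have "Ck_on k S f" "Ck_on k S g" using fg Ck_on_Suc_imp by blast+
  then show ?case using d
    by (auto intro!: exI[of _ "\<lambda>x. g x *\<^sub>R f' x + f x *\<^sub>R g' x"] derivative_eq_intros
        Suc.IH Ck_on_add simp: inner_add_left)
qed (auto intro!: continuous_intros)

lemma Ck_on_prod: "finite I \<Longrightarrow> (\<And>i. i \<in> I \<Longrightarrow> Ck_on k S (f i)) \<Longrightarrow> Ck_on k S (\<lambda>x. \<Prod>i\<in>I. f i x)"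
  by (induction I rule: finite_induct) (auto intro: Ck_on_const Ck_on_mult)

lemma Ck_on_sin_component: "Ck_on k UNIV (\<lambda>x::real^'n. sin (c * x $ i + b))"
proof (induction k arbitrary: b)
  case (Suc k)
  have "Ck_on k UNIV (\<lambda>x::real^'n. (cos (c * x $ i + b) *\<^sub>R c *\<^sub>R axis i 1) \<bullet> e)" for e :: "real^'n"
  proof -
    have "(\<lambda>x::real^'n. (cos (c * x $ i + b) *\<^sub>R c *\<^sub>R axis i 1) \<bullet> e)
        = (\<lambda>x. sin (c * x $ i + (b + pi / 2)) * (c * (e $ i)))"
      by (simp add: inner_axis' sin_add add.assoc[symmetric] mult.assoc)
    then show ?thesis using Ck_on_mult[OF Suc Ck_on_const] by simp
  qed
  then show ?case
    by (auto intro!: exI[of _ "\<lambda>x. cos (c * x $ i + b) *\<^sub>R c *\<^sub>R axis i 1"]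
        derivative_eq_intros bounded_linear_imp_has_derivative[OF bounded_linear_vec_nth]
        simp: inner_axis' algebra_simps)
qed (auto intro!: continuous_intros)

text \<open>The logistic function; its derivative is a polynomial in itself, which makes smoothness of
  compositions with it an easy induction.\<close>

definition logistic :: "real \<Rightarrow> real" where
  "logistic t = 1 / (1 + exp (- t))"

lemma logistic_bounds: "0 < logistic t" "logistic t < 1"
  by (auto simp: logistic_def add_pos_pos)

lemma logistic_deriv:
  "(logistic has_real_derivative logistic t * (1 - logistic t)) (at t)"
proof -
  have "1 + exp (- t) \<noteq> (0::real)" by (smt (verit) exp_gt_zero)
  then show ?thesis unfolding logistic_def[abs_def]
    by (auto intro!: derivative_eq_intros simp: field_simps power2_eq_square)
qed

lemma Ck_on_logistic: "Ck_on k S f \<Longrightarrow> Ck_on k S (\<lambda>x. logistic (f x))"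
proof (induction k arbitrary: f)
  case 0
  have "continuous_on UNIV logistic"
    by (meson DERIV_continuous_on has_field_derivative_at_within logistic_deriv)
  then show ?case using 0 by (auto intro: continuous_on_compose2)
next
  case (Suc k)
  note f = Suc.prems
  then obtain f' where
    d: "\<forall>x\<in>S. (f has_derivative (\<lambda>h. f' x \<bullet> h)) (at x within S)"
    "\<forall>b\<in>Basis. Ck_on k S (\<lambda>x. f' x \<bullet> b)" by auto
  let ?L = "\<lambda>x. logistic (f x)"
  have L: "Ck_on k S ?L" using Suc f Ck_on_Suc_imp by blast
  have "Ck_on k S (\<lambda>x. 1 + (-1) * ?L x)" by (intro Ck_on_add Ck_on_const Ck_on_mult L)
  then have "\<forall>b\<in>Basis. Ck_on k S (\<lambda>x. (?L x * (1 + (-1) * ?L x)) * (f' x \<bullet> b))"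
    using d(2) L by (auto intro!: Ck_on_mult)
  moreover have "\<forall>x\<in>S. (?L has_derivative (\<lambda>h. ((?L x * (1 + (-1) * ?L x)) *\<^sub>R f' x) \<bullet> h)) (at x within S)"
  proof
    fix x assume "x \<in> S"
    then have "(f has_derivative (\<lambda>h. f' x \<bullet> h)) (at x within S)" using d by auto
    from has_derivative_compose[OF this logistic_deriv[unfolded has_field_derivative_def]]
    show "(?L has_derivative (\<lambda>h. ((?L x * (1 + (-1) * ?L x)) *\<^sub>R f' x) \<bullet> h)) (at x within S)"
      by (simp add: algebra_simps)
  qed
  ultimately show ?case
    unfolding Ck_on.simps inner_scaleR_left[symmetric] by (intro exI conjI)
qed

lemma logistic_scale_tendsto:
  "(\<lambda>k. logistic (real k * s)) \<longlonglongrightarrow> (if s > 0 then 1 else if s = 0 then 1 / 2 else 0)"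
proof -
  consider "s > 0" | "s = 0" | "s < 0" by linarith
  then show ?thesis
  proof cases
    case 1
    then have "(\<lambda>k. 1 / (1 + exp (- (real k * s)))) \<longlonglongrightarrow> 1" by real_asymp
    then show ?thesis using 1 by (simp add: logistic_def)
  next
    case 2 then show ?thesis by (simp add: logistic_def)
  next
    case 3
    then have "(\<lambda>k. 1 / (1 + exp (- (real k * s)))) \<longlonglongrightarrow> 0" by real_asymp
    then show ?thesis using 3 by (simp add: logistic_def)
  qed
qed

text \<open>Smooth periodic approximations, as \<open>k \<rightarrow> \<infinity>\<close>, of the indicator of the box \<open>cbox 0 a\<close> in the unit cube.
  For \<open>0 < s < 1\<close> and \<open>0 \<le> a \<le> 1\<close>, the product \<open>sin (\<pi> s) sin (\<pi> (a - s))\<close> has the sign of \<open>a - s\<close>,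
  and it is periodic in \<open>s\<close> with period 1 because both factors change sign.\<close>

definition box_bump :: "real ^ 'n \<Rightarrow> nat \<Rightarrow> real ^ 'n \<Rightarrow> real" where
  "box_bump a k x = (\<Prod>i\<in>UNIV. logistic (real k * (sin (pi * x $ i) * sin (pi * (a $ i - x $ i)))))"

lemma smooth_box_bump: "smooth_on UNIV (box_bump (a :: real ^ 'n) k)"
  unfolding smooth_on_def
proof
  fix j
  have "Ck_on j UNIV (\<lambda>x::real^'n. sin (pi * x $ i) * sin (pi * (a $ i - x $ i)))" for i
    using Ck_on_mult[OF Ck_on_sin_component[of j pi i 0] Ck_on_sin_component[of j "-pi" i "pi * a $ i"]]
    by (simp add: algebra_simps)
  then have "Ck_on j UNIV (\<lambda>x. logistic (real k * (sin (pi * x $ i) * sin (pi * (a $ i - x $ i)))))" for i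
    by (intro Ck_on_logistic) (rule Ck_on_mult[OF Ck_on_const])
  then show "Ck_on j UNIV (box_bump a k)"
    unfolding box_bump_def by (rule Ck_on_prod[OF finite])
qed

lemma periodic_box_bump: "periodic (box_bump a k)"
proof -
  have "sin (pi * (x + z)) * sin (pi * (b - (x + z))) = sin (pi * x) * sin (pi * (b - x))"
    if z: "z \<in> \<int>" for x z b :: real
  proof -
    obtain n where n: "z = of_int n" using Ints_cases[OF z] by blast
    have s: "sin (pi * z) = 0" unfolding n using sin_npi_int by (simp add: mult.commute)
    then have c: "cos (pi * z) * cos (pi * z) = 1" using sin_cos_squared_add2[of "pi * z"]
      by (simp add: power2_eq_square)
    have "sin (pi * (x + z)) = sin (pi * x) * cos (pi * z)"
      by (simp add: distrib_left sin_add s)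
    moreover have "sin (pi * (b - (x + z))) = sin (pi * (b - x)) * cos (pi * z)"
      using sin_diff[of "pi * (b - x)" "pi * z"] by (simp add: s algebra_simps)
    ultimately have "sin (pi * (x + z)) * sin (pi * (b - (x + z)))
        = sin (pi * x) * sin (pi * (b - x)) * (cos (pi * z) * cos (pi * z))"
      by (simp only: mult_ac)
    then show ?thesis by (simp add: c)
  qed
  then show ?thesis unfolding periodic_def box_bump_def by simp
qed

lemma box_bump_bound: "\<bar>box_bump a k x\<bar> \<le> 1"
  unfolding box_bump_def abs_prod
  by (rule prod_le_1) (use logistic_bounds in \<open>auto simp: abs_of_pos less_imp_le\<close>)

lemma box_bump_tendsto:
  assumes x: "\<And>i. 0 < x $ i \<and> x $ i < 1" and a: "\<And>i. 0 \<le> a $ i \<and> a $ i \<le> 1"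
    and ne: "\<And>i. x $ i \<noteq> a $ i"
  shows "(\<lambda>k. box_bump a k x) \<longlonglongrightarrow> indicator (cbox 0 a) x"
proof -
  have lim0: "(\<lambda>k. logistic (real k * s)) \<longlonglongrightarrow> 0" if "s < 0" for s
    using logistic_scale_tendsto[of s] that by simp
  have "(\<lambda>k. logistic (real k * (sin (pi * x $ i) * sin (pi * (a $ i - x $ i)))))
      \<longlonglongrightarrow> (if x $ i < a $ i then 1 else 0)" for i
  proof -
    have p: "sin (pi * x $ i) > 0" using x[of i] by (intro sin_gt_zero) auto
    have q: "sin (pi * y) > 0" if "0 < y" "y < 1" for y using that by (intro sin_gt_zero) auto
    show ?thesis
    proof (cases "x $ i < a $ i")
      case True
      then have "sin (pi * (a $ i - x $ i)) > 0" using x[of i] a[of i] by (intro q) auto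
      then have "sin (pi * x $ i) * sin (pi * (a $ i - x $ i)) > 0" using p by simp
      then show ?thesis using logistic_scale_tendsto[of "sin (pi * x $ i) * sin (pi * (a $ i - x $ i))"] True by simp
    next
      case False
      then have "sin (pi * (x $ i - a $ i)) > 0" using x[of i] a[of i] ne[of i] by (intro q) linarith+
      moreover have "sin (pi * (a $ i - x $ i)) = - sin (pi * (x $ i - a $ i))"
        using sin_minus[of "pi * (x $ i - a $ i)"] by (simp add: algebra_simps)
      ultimately have "sin (pi * x $ i) * sin (pi * (a $ i - x $ i)) < 0"
        using p by (simp add: mult_pos_neg)
      from lim0[OF this] show ?thesis using False by simp
    qed
  qed
  then have "(\<lambda>k. box_bump a k x) \<longlonglongrightarrow> (\<Prod>i\<in>UNIV. (if x $ i < a $ i then 1 else 0))"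
    unfolding box_bump_def by (intro tendsto_prod) auto
  moreover have "(\<Prod>i\<in>UNIV. (if x $ i < a $ i then 1 else 0)) = (indicator (cbox 0 a) x :: real)"
  proof (cases "\<forall>i. x $ i < a $ i")
    case True
    then have "x \<in> cbox 0 a" using x by (auto simp: mem_box_cart less_imp_le)
    then show ?thesis using True by simp
  next
    case False
    then obtain i where i: "\<not> x $ i < a $ i" by auto
    then have "\<not> x $ i \<le> a $ i" using ne[of i] by linarith
    then have "x \<notin> cbox 0 a" unfolding mem_box_cart by blast
    moreover have "(\<Prod>i\<in>UNIV. (if x $ i < a $ i then 1 else 0)) = (0::real)"
      using i by (intro prod_zero) auto
    ultimately show ?thesis by simp
  qed
  ultimately show ?thesis by simp
qed

section \<open>Uniqueness of the weak gradient\<close>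

text \<open>The sets \<open>{..a}\<close> meet the unit cube in these boxes, are stable under intersection and generate the
  Borel sets; a Lebesgue measurable set differs from a Borel set by a null set.\<close>

lemma AE_zero_of_box_integrals:
  fixes f :: "real ^ 'n \<Rightarrow> real"
  assumes f: "integrable torus f"
    and box: "\<And>a. (\<And>i. 0 \<le> a $ i \<and> a $ i \<le> 1) \<Longrightarrow> (LINT x|torus. indicator (cbox 0 a) x * f x) = 0"
  shows "AE x in torus. f x = 0"
proof -
  let ?E = "range (\<lambda>a::real^'n. {..a})"
  define I where "I B = (LINT x|torus. indicator B x * f x)" for B :: "(real^'n) set"
  have sets: "B \<inter> cbox 0 1 \<in> sets torus" if "B \<in> sets borel" for B :: "(real^'n) set"
    using that by (auto simp: sets_restrict_space)
  have int: "integrable torus (\<lambda>x. indicator B x * f x)" if "B \<in> sets borel" for B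
  proof -
    have "B \<inter> space torus \<in> sets torus" using sets[OF that] by simp
    then have "integrable torus (\<lambda>x. indicator (B \<inter> space torus) x *\<^sub>R f x)"
      by (intro integrable_mult_indicator f)
    also have "?this \<longleftrightarrow> integrable torus (\<lambda>x. indicator B x * f x)"
      by (intro Bochner_Integration.integrable_cong refl) (auto simp: indicator_def)
    finally show ?thesis .
  qed
  have low: "I {..a} = 0" for a
  proof (cases "\<forall>i. 0 \<le> a $ i")
    case True
    have "I {..a} = (LINT x|torus. indicator (cbox 0 (\<chi> i. min (a $ i) 1)) x * f x)"
      unfolding I_def
      by (rule Bochner_Integration.integral_cong)
        (auto simp: indicator_def mem_box_cart Finite_Cartesian_Product.less_eq_vec_def)
    then show ?thesis using box[of "\<chi> i. min (a $ i) 1"] True by auto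
  next
    case False
    have "I {..a} = (LINT x|(torus :: (real^'n) measure). 0)"
      unfolding I_def using False
      by (intro Bochner_Integration.integral_cong)
        (auto simp: indicator_def mem_box_cart Finite_Cartesian_Product.less_eq_vec_def intro: order_trans)
    then show ?thesis by simp
  qed
  have UN: "UNIV = (\<Union>n::nat. {..(\<chi> i. real n)::real^'n})"
  proof -
    have "\<exists>n::nat. x \<le> (\<chi> i. real n)" for x :: "real^'n"
    proof -
      obtain n :: nat where "norm x \<le> real n" using real_arch_simple by blast
      then have "x $ i \<le> real n" for i using component_le_norm_cart[of x i] by (smt (verit))
      then show ?thesis by (auto simp: Finite_Cartesian_Product.less_eq_vec_def)
    qed
    then show ?thesis by auto
  qed
  have one: "I UNIV = 0"
  proof -
    have "I {..(1::real^'n)} = I UNIV" unfolding I_def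
      by (intro Bochner_Integration.integral_cong)
        (auto simp: indicator_def mem_box_cart Finite_Cartesian_Product.less_eq_vec_def)
    then show ?thesis using low by simp
  qed
  have bor: "B \<in> sets borel \<Longrightarrow> I B = 0" for B
  proof -
    have E: "Int_stable ?E"
    proof (rule Int_stableI)
      fix A B assume "A \<in> ?E" "B \<in> ?E"
      then obtain a b where "A = {..a}" "B = {..b}" by auto
      then have "A \<inter> B = {..inf a b}" by auto
      then show "A \<inter> B \<in> ?E" by auto
    qed
    assume B: "B \<in> sets borel"
    then have "B \<in> sigma_sets UNIV ?E" by (simp add: borel_eq_atMost)
    moreover have meas: "A \<in> sets borel" if "A \<in> sigma_sets UNIV ?E" for A
      using that by (simp add: borel_eq_atMost)
    moreover have "?E \<subseteq> Pow UNIV" by simp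
    ultimately show "I B = 0"
    proof (induction rule: sigma_sets_induct_disjoint[OF E \<open>?E \<subseteq> Pow UNIV\<close>, consumes 1, case_names basic empty compl union])
      case (basic A)
      then show ?case using low by auto
    next
      case empty
      show ?case by (simp add: I_def)
    next
      case (compl A)
      have "I (UNIV - A) = (LINT x|torus. indicator UNIV x * f x - indicator A x * f x)"
        unfolding I_def by (intro Bochner_Integration.integral_cong) (auto simp: indicator_def)
      also have "\<dots> = I UNIV - I A"
        unfolding I_def using compl meas by (intro Bochner_Integration.integral_diff int) auto
      finally show ?case using compl one by simp
    next
      case (union A)
      let ?Q = "cbox 0 (1::real^'n)"
      have I: "I B = set_lebesgue_integral torus (B \<inter> ?Q) f" for B
        unfolding I_def set_lebesgue_integral_def
        by (intro Bochner_Integration.integral_cong) (auto simp: indicator_def)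
      have A: "A n \<in> sets borel" for n using union meas by auto
      have "set_lebesgue_integral torus (\<Union>n. A n \<inter> ?Q) f
          = (\<Sum>n. set_lebesgue_integral torus (A n \<inter> ?Q) f)"
      proof (rule lebesgue_integral_countable_add)
        show *: "A n \<inter> ?Q \<in> sets torus" for n by (rule sets[OF A])
        show "A i \<inter> ?Q \<inter> (A j \<inter> ?Q) = {}" if "i \<noteq> j" for i j
          using union that by (auto simp: disjoint_family_on_def)
        have "(\<Union>n. A n \<inter> ?Q) \<in> sets torus" using * by (intro sets.countable_UN) auto
        then show "set_integrable torus (\<Union>n. A n \<inter> ?Q) f"
          unfolding set_integrable_def by (intro integrable_mult_indicator f)
      qed
      also have "\<dots> = 0" using union by (simp add: I[symmetric])
      finally show ?case by (simp add: I)
    qed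
  qed
  interpret finite_measure "torus :: (real^'n) measure"
    by (intro finite_measure_lebesgue_on lmeasurable_cbox)
  show ?thesis
  proof (rule density_zero)
    show "integrable torus f" by (rule f)
    fix A assume "A \<in> sets (torus :: (real^'n) measure)"
    then have A: "A \<in> sets (completion lborel)" "A \<subseteq> cbox 0 1"
      by (auto simp: sets_restrict_space_iff)
    from sets_completionE[OF A(1)] obtain S N N'
      where S: "A = S \<union> N" "N \<subseteq> N'" "N' \<in> null_sets lborel" "S \<in> sets lborel" by metis
    have "AE x in lebesgue. x \<notin> N'"
      using S by (intro AE_completion AE_not_in)
    then have "AE x in torus. x \<notin> N'"
      by (auto simp: AE_restrict_space_iff elim!: eventually_mono)
    then have ae: "AE x in torus. indicator S x * f x = indicator A x * f x"
      by eventually_elim (use S in \<open>auto simp: indicator_def\<close>)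
    have "indicator A \<in> borel_measurable torus"
      using \<open>A \<in> sets torus\<close> by simp
    then have "I S = (LINT x|torus. indicator A x * f x)"
      unfolding I_def using S f int[of S]
      by (intro integral_cong_AE ae) (auto intro!: borel_measurable_times)
    then show "set_lebesgue_integral torus A f = 0"
      using bor S by (simp add: set_lebesgue_integral_def)
  qed
qed

lemma borel_measurable_torus_continuous:
  fixes f :: "real ^ 'n \<Rightarrow> 'b::euclidean_space"
  assumes "continuous_on UNIV f"
  shows "f \<in> borel_measurable torus"
  using assms by (intro measurable_restrict_space1 measurable_completion) (simp add: borel_measurable_continuous_onI)

lemma AE_torus_component_neq: "AE x :: real ^ 'n in torus. x $ i \<noteq> c"
proof -
  have "{x :: real^'n. x $ i = c} \<in> null_sets lebesgue"
    using negligible_standard_hyperplane[of "axis i 1 :: real^'n" c]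
    by (simp add: negligible_iff_null_sets inner_axis)
  from AE_not_in[OF this] show ?thesis by (auto simp: AE_restrict_space_iff elim!: eventually_mono)
qed

lemma AE_zero_if_orthogonal_to_smooth:
  fixes f :: "real ^ 'n \<Rightarrow> real"
  assumes f: "integrable torus f"
    and orth: "\<And>\<phi>. smooth_on UNIV \<phi> \<Longrightarrow> periodic \<phi> \<Longrightarrow> (LINT x|torus. f x * \<phi> x) = 0"
  shows "AE x in torus. f x = 0"
proof (rule AE_zero_of_box_integrals[OF f])
  fix a :: "real^'n" assume a: "\<And>i. 0 \<le> a $ i \<and> a $ i \<le> 1"
  have m: "f \<in> borel_measurable torus" using f by auto
  have mb: "box_bump a k \<in> borel_measurable torus" for k
    using smooth_box_bump[of a k] unfolding smooth_on_def
    by (intro borel_measurable_torus_continuous Ck_on_continuous) auto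
  have "(\<lambda>k. LINT x|torus. f x * box_bump a k x) \<longlonglongrightarrow> (LINT x|torus. f x * indicator (cbox 0 a) x)"
  proof (rule integral_dominated_convergence)
    show "integrable torus (\<lambda>x. \<bar>f x\<bar>)" using f by simp
    have "AE x in torus. \<forall>i\<in>UNIV. x $ i \<noteq> 0 \<and> x $ i \<noteq> 1 \<and> x $ i \<noteq> a $ i"
      by (intro AE_finite_allI finite AE_conjI AE_torus_component_neq)
    then show "AE x in torus. (\<lambda>k. f x * box_bump a k x) \<longlonglongrightarrow> f x * indicator (cbox 0 a) x"
      using AE_space
    proof eventually_elim
      case (elim x)
      then have "0 \<le> x $ i \<and> x $ i \<le> 1" for i by (auto simp: mem_box_cart)
      then have "0 < x $ i \<and> x $ i < 1" for i using elim by (metis UNIV_I order_le_less)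
      then show ?case using elim a by (intro tendsto_mult tendsto_const box_bump_tendsto) auto
    qed
    show "AE x in torus. norm (f x * box_bump a k x) \<le> \<bar>f x\<bar>" for k
      using box_bump_bound[of a k] by (auto simp: abs_mult intro!: mult_left_le)
    have "indicator (cbox 0 a) \<in> borel_measurable (torus :: (real^'n) measure)"
      by (intro measurable_restrict_space1 measurable_completion) simp
    then show "(\<lambda>x. f x * indicat_real (cbox 0 a) x) \<in> borel_measurable torus"
      using m by (rule borel_measurable_times[rotated])
    show "(\<lambda>x. f x * box_bump a k x) \<in> borel_measurable torus" for k
      by (intro borel_measurable_times m mb)
  qed
  moreover have "(LINT x|torus. f x * box_bump a k x) = 0" for k
    by (intro orth smooth_box_bump periodic_box_bump)
  ultimately show "(LINT x|torus. indicator (cbox 0 a) x * f x) = 0"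
    using LIMSEQ_unique[OF tendsto_const, of 0] by (simp add: mult.commute)
qed

lemma integrable_torus_if_square:
  fixes f :: "real ^ 'n \<Rightarrow> real"
  assumes "f \<in> borel_measurable torus" "integrable torus (\<lambda>x. (f x)\<^sup>2)"
  shows "integrable torus f"
proof -
  interpret finite_measure torus by (intro finite_measure_lebesgue_on lmeasurable_cbox)
  show ?thesis using square_integrable_imp_integrable[OF assms] .
qed

text \<open>Each component of the difference is orthogonal to all smooth periodic functions.\<close>

lemma has_weak_grad_unique:
  assumes g: "has_weak_grad u g" and h: "has_weak_grad u h"
  shows "AE x in torus. g x = h x"
proof -
  have int: "integrable torus (\<lambda>x. g x $ i)" if "has_weak_grad u g" for g i
  proof (rule integrable_torus_if_square)
    have m: "g \<in> borel_measurable torus" and n: "integrable torus (\<lambda>x. (norm (g x))\<^sup>2)"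
      using that by (auto simp: has_weak_grad_def)
    show mi: "(\<lambda>x. g x $ i) \<in> borel_measurable torus"
      using m by (rule borel_measurable_continuous_on[rotated]) (intro continuous_intros)
    show "integrable torus (\<lambda>x. (g x $ i)\<^sup>2)"
    proof (rule Bochner_Integration.integrable_bound[OF n])
      show "(\<lambda>x. (g x $ i)\<^sup>2) \<in> borel_measurable torus" using mi by (rule borel_measurable_power)
      show "AE x in torus. norm ((g x $ i)\<^sup>2) \<le> norm ((norm (g x))\<^sup>2)"
        using power_mono[OF component_le_norm_cart, of _ i 2] by simp
    qed
  qed
  have "AE x in torus. g x $ i - h x $ i = 0" for i
  proof (rule AE_zero_if_orthogonal_to_smooth)
    show "integrable torus (\<lambda>x. g x $ i - h x $ i)"
      using int[OF g] int[OF h] by auto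
    fix \<phi> :: "real^'a \<Rightarrow> real" assume \<phi>: "smooth_on UNIV \<phi>" "periodic \<phi>"
    have c: "continuous_on UNIV \<phi>" using \<phi> by (auto simp: smooth_on_def intro: Ck_on_continuous[of 0])
    then have "bounded (\<phi> ` cbox 0 1)"
      by (intro compact_imp_bounded compact_continuous_image) (auto intro: continuous_on_subset)
    then obtain B where B: "\<And>x. x \<in> cbox 0 1 \<Longrightarrow> \<bar>\<phi> x\<bar> \<le> B" by (force simp: bounded_iff)
    have i: "integrable torus (\<lambda>x. k x $ i * \<phi> x)" if "has_weak_grad u k" for k
    proof (rule Bochner_Integration.integrable_bound)
      show "integrable torus (\<lambda>x. B * (k x $ i))" using int[OF that] by simp
      show "(\<lambda>x. k x $ i * \<phi> x) \<in> borel_measurable torus"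
        by (intro borel_measurable_times borel_measurable_torus_continuous[OF c]
            borel_measurable_integrable int[OF that])
      show "AE x in torus. norm (k x $ i * \<phi> x) \<le> norm (B * (k x $ i))"
        using AE_space
      proof eventually_elim
        case (elim x)
        then have "\<bar>\<phi> x\<bar> \<le> \<bar>B\<bar>" using B[of x] by auto
        then show ?case by (simp add: abs_mult mult.commute mult_right_mono)
      qed
    qed
    have "(LINT x|torus. g x $ i * \<phi> x) = (LINT x|torus. h x $ i * \<phi> x)"
      using g h \<phi> by (auto simp: has_weak_grad_def)
    then show "(LINT x|torus. (g x $ i - h x $ i) * \<phi> x) = 0"
      using i[OF g] i[OF h] by (simp add: left_diff_distrib)
  qed
  then have "AE x in torus. \<forall>i\<in>UNIV. g x $ i - h x $ i = 0"
    by (intro AE_finite_allI) auto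
  then show ?thesis by eventually_elim (simp add: Finite_Cartesian_Product.vec_eq_iff)
qed

section \<open>Continuously differentiable periodic functions\<close>

text \<open>The integral over a period cell is translation invariant: the part of the shifted cube that
  leaves the unit cube through one face is moved back through the opposite face.\<close>

lemma integral_periodic_shift:
  fixes f :: "real ^ 'n \<Rightarrow> real"
  assumes p: "periodic f" and c: "continuous_on UNIV f" and s: "0 \<le> s" "s \<le> 1"
  shows "integral (cbox 0 1) (\<lambda>x. f (x + s *\<^sub>R axis i 1)) = integral (cbox 0 1) f"
proof -
  let ?e = "axis i 1 :: real^'n"
  have int: "f integrable_on cbox a b" for a b
    using c by (intro integrable_continuous) (auto intro: continuous_on_subset)
  have e: "?e \<in> Basis" by simp
  \<comment> \<open>In the boxes below only coordinate \<open>i\<close> differs from the unit cube.\<close>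
  have mem: "x \<in> cbox a b \<longleftrightarrow> (a $ i \<le> x $ i \<and> x $ i \<le> b $ i) \<and>
      (\<forall>j. j \<noteq> i \<longrightarrow> a $ j \<le> x $ j \<and> x $ j \<le> b $ j)" for a b x :: "real^'n"
    unfolding mem_box_cart by metis
  have ei: "?e $ i = 1" "j \<noteq> i \<Longrightarrow> ?e $ j = 0" for j
    by (auto simp: axis_def)
  have "integral (cbox 0 1) (\<lambda>x. f (x + s *\<^sub>R ?e)) = integral (cbox (s *\<^sub>R ?e) (1 + s *\<^sub>R ?e)) f"
    using integral_shift_cbox_plus[of 0 1 f "s *\<^sub>R ?e"] by (simp add: o_def add.commute)
  also have "\<dots> = integral (cbox (s *\<^sub>R ?e) (1 + s *\<^sub>R ?e) \<inter> {x. x \<bullet> ?e \<le> 1}) f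
      + integral (cbox (s *\<^sub>R ?e) (1 + s *\<^sub>R ?e) \<inter> {x. x \<bullet> ?e \<ge> 1}) f"
    by (rule integral_split[OF int e])
  also have "cbox (s *\<^sub>R ?e) (1 + s *\<^sub>R ?e) \<inter> {x. x \<bullet> ?e \<le> 1} = cbox 0 1 \<inter> {x. x \<bullet> ?e \<ge> s}"
    using s by (auto simp: set_eq_iff mem ei inner_axis)
  also have "cbox (s *\<^sub>R ?e) (1 + s *\<^sub>R ?e) \<inter> {x. x \<bullet> ?e \<ge> 1} = cbox (0 + ?e) ((1 - ?e + s *\<^sub>R ?e) + ?e)"
    using s by (auto simp: set_eq_iff mem ei inner_axis)
  also have "integral (cbox (0 + ?e) ((1 - ?e + s *\<^sub>R ?e) + ?e)) f
      = integral (cbox 0 (1 - ?e + s *\<^sub>R ?e)) (\<lambda>x. f (x + ?e))"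
    using integral_shift_cbox_plus[of 0 "1 - ?e + s *\<^sub>R ?e" f ?e] by (simp add: o_def add.commute)
  also have "(\<lambda>x. f (x + ?e)) = f"
    using p by (auto simp: periodic_def axis_def)
  also have "cbox 0 (1 - ?e + s *\<^sub>R ?e) = cbox 0 1 \<inter> {x. x \<bullet> ?e \<le> s}"
    using s by (auto simp: set_eq_iff mem ei inner_axis)
  finally show ?thesis using integral_split[OF int e, of 0 1 s] by simp
qed

text \<open>\<open>f\<close> is a continuously differentiable function on the torus and \<open>g\<close> is its gradient.\<close>

definition C1_per :: "(real ^ 'n \<Rightarrow> real) \<Rightarrow> (real ^ 'n \<Rightarrow> real ^ 'n) \<Rightarrow> bool" where
  "C1_per f g \<longleftrightarrow> periodic f \<and> continuous_on UNIV g \<and>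
     (\<forall>x. (f has_derivative (\<lambda>h. g x \<bullet> h)) (at x))"

lemma C1_per_continuous:
  assumes "C1_per f g"
  shows "continuous_on UNIV f" "continuous_on UNIV g"
  using assms unfolding C1_per_def
  by (auto intro!: has_derivative_continuous continuous_at_imp_continuous_on)

lemma integrable_torus_continuous:
  fixes f :: "real ^ 'n \<Rightarrow> real"
  shows "continuous_on UNIV f \<Longrightarrow> integrable torus f"
  by (intro continuous_imp_integrable) (auto intro: continuous_on_subset)

lemma integral_torus_eq: 
  fixes f :: "real ^ 'n \<Rightarrow> real"
  shows "continuous_on UNIV f \<Longrightarrow> (LINT x|torus. f x) = integral (cbox 0 1) f"
  by (intro lebesgue_integral_eq_integral integrable_torus_continuous) auto

text \<open>The difference quotients in a coordinate direction have vanishing integral by translation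
  invariance, and they converge boundedly to the partial derivative.\<close>

lemma C1_per_integral_grad:
  assumes f: "C1_per f g"
  shows "(LINT x|torus. g x $ i) = 0"
proof -
  let ?e = "axis i 1 :: real^'a"
  \<comment> \<open>Step sizes tending to zero, at most 1 so that shifted points stay in \<open>cbox 0 2\<close>.\<close>
  define h where "h n = inverse (real (Suc n))" for n
  have h: "0 < h n" "h n \<le> 1" for n by (auto simp: h_def field_simps)
  define q where "q n x = (f (x + h n *\<^sub>R ?e) - f x) / h n" for n x
  note c = C1_per_continuous[OF f]
  have cs: "continuous_on UNIV (\<lambda>x. f (x + h n *\<^sub>R ?e))" for n
    by (rule continuous_on_compose2[OF c(1)]) (auto intro!: continuous_intros)
  have cq: "continuous_on UNIV (q n)" for n
    unfolding q_def using c(1) cs h(1)[of n] by (intro continuous_intros) auto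
  have line: "((\<lambda>t. f (x + t *\<^sub>R ?e)) has_real_derivative g (x + t *\<^sub>R ?e) $ i) (at t within S)" for x t S
  proof -
    have "(f has_derivative (\<lambda>h. g (x + t *\<^sub>R ?e) \<bullet> h)) (at (x + t *\<^sub>R ?e))"
      using f by (auto simp: C1_per_def)
    then have "((\<lambda>t. f (x + t *\<^sub>R ?e)) has_derivative (\<lambda>y. g (x + t *\<^sub>R ?e) \<bullet> (y *\<^sub>R ?e))) (at t within S)"
      by (rule has_derivative_compose[rotated]) (auto intro!: derivative_eq_intros)
    moreover have "(\<lambda>y. g (x + t *\<^sub>R ?e) \<bullet> (y *\<^sub>R ?e)) = (*) (g (x + t *\<^sub>R ?e) $ i)"
      by (simp add: fun_eq_iff inner_axis)
    ultimately show ?thesis by (simp add: has_field_derivative_def)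
  qed
  have lim: "(\<lambda>n. q n x) \<longlonglongrightarrow> g x $ i" for x
  proof -
    have "((\<lambda>t. (f (x + t *\<^sub>R ?e) - f x) / t) \<longlongrightarrow> g x $ i) (at 0)"
      using line[of x 0 UNIV] by (simp add: DERIV_def)
    moreover have "filterlim h (at 0) sequentially"
      unfolding h_def using LIMSEQ_inverse_real_of_nat by (auto simp: filterlim_at)
    ultimately show ?thesis unfolding q_def by (rule filterlim_compose)
  qed
  have "bounded ((\<lambda>x. g x $ i) ` cbox 0 2)"
    by (intro compact_imp_bounded compact_continuous_image)
      (auto intro!: continuous_intros continuous_on_subset[OF c(2)])
  then obtain B where B: "\<And>x. x \<in> cbox 0 2 \<Longrightarrow> \<bar>g x $ i\<bar> \<le> B" by (force simp: bounded_iff)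
  have bound: "\<bar>q n x\<bar> \<le> B" if x: "x \<in> cbox 0 1" for n x
  proof -
    obtain z where z: "0 < z" "z < h n" "f (x + h n *\<^sub>R ?e) - f (x + 0 *\<^sub>R ?e) = (h n - 0) * g (x + z *\<^sub>R ?e) $ i"
      using MVT2[of 0 "h n" "\<lambda>t. f (x + t *\<^sub>R ?e)" "\<lambda>t. g (x + t *\<^sub>R ?e) $ i"] h(1)[of n] line by metis
    have "x + z *\<^sub>R ?e \<in> cbox 0 2"
    proof -
      have "0 \<le> x $ j \<and> x $ j \<le> 1" for j using x by (auto simp: mem_box_cart)
      moreover have "0 \<le> (z *\<^sub>R ?e) $ j \<and> (z *\<^sub>R ?e) $ j \<le> 1" for j
        using z h(2)[of n] by (auto simp: axis_def)
      ultimately have "0 \<le> x $ j + (z *\<^sub>R ?e) $ j \<and> x $ j + (z *\<^sub>R ?e) $ j \<le> 2" for j by (smt (verit))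
      then show ?thesis by (simp add: mem_box_cart)
    qed
    moreover have "q n x = g (x + z *\<^sub>R ?e) $ i" using z(3) h(1)[of n] by (simp add: q_def)
    ultimately show ?thesis using B by metis
  qed
  have zero: "(LINT x|torus. q n x) = 0" for n
  proof -
    have "(LINT x|torus. q n x) = (LINT x|torus. f (x + h n *\<^sub>R ?e) - f x) / h n"
      unfolding q_def by simp
    also have "(LINT x|torus. f (x + h n *\<^sub>R ?e) - f x) = (LINT x|torus. f (x + h n *\<^sub>R ?e)) - (LINT x|torus. f x)"
      by (intro Bochner_Integration.integral_diff integrable_torus_continuous c cs)
    also have "\<dots> = 0"
      using integral_periodic_shift[of f "h n" i] f h[of n] c(1)
      by (simp add: integral_torus_eq cs C1_per_def)
    finally show ?thesis by simp
  qed
  have "(\<lambda>n. LINT x|torus. q n x) \<longlonglongrightarrow> (LINT x|torus. g x $ i)"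
  proof (rule integral_dominated_convergence)
    show "integrable torus (\<lambda>x::real^'a. B)" by (intro integrable_torus_continuous continuous_intros)
    show "(\<lambda>x. g x $ i) \<in> borel_measurable torus"
      by (intro borel_measurable_torus_continuous continuous_intros c)
    show "q n \<in> borel_measurable torus" for n
      by (intro borel_measurable_torus_continuous cq)
    show "AE x in torus. (\<lambda>n. q n x) \<longlonglongrightarrow> g x $ i" using lim by simp
    show "AE x in torus. norm (q n x) \<le> B" for n
      using AE_space by eventually_elim (auto intro!: bound)
  qed
  then show ?thesis using LIMSEQ_unique[OF tendsto_const, of 0] by (simp add: zero)
qed

lemma C1_per_mult:
  assumes "C1_per f g" "C1_per f' g'"
  shows "C1_per (\<lambda>x. f x * f' x) (\<lambda>x. f' x *\<^sub>R g x + f x *\<^sub>R g' x)"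
  using assms C1_per_continuous[OF assms(1)] C1_per_continuous[OF assms(2)] unfolding C1_per_def
  by (auto intro!: derivative_eq_intros continuous_intros simp: periodic_def inner_add_left)

lemma C1_per_sum:
  assumes "\<And>k. k \<in> I \<Longrightarrow> C1_per (f k) (g k)"
  shows "C1_per (\<lambda>x. \<Sum>k\<in>I. c k * f k x) (\<lambda>x. \<Sum>k\<in>I. c k *\<^sub>R g k x)"
  unfolding C1_per_def
proof (intro conjI allI)
  show "periodic (\<lambda>x. \<Sum>k\<in>I. c k * f k x)"
    using assms by (auto simp: C1_per_def periodic_def)
  show "continuous_on UNIV (\<lambda>x. \<Sum>k\<in>I. c k *\<^sub>R g k x)"
    using assms by (intro continuous_intros C1_per_continuous)
  show "((\<lambda>x. \<Sum>k\<in>I. c k * f k x) has_derivative (\<lambda>h. (\<Sum>k\<in>I. c k *\<^sub>R g k x) \<bullet> h)) (at x)" for x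
  proof -
    have "((\<lambda>x. \<Sum>k\<in>I. c k * f k x) has_derivative (\<lambda>h. \<Sum>k\<in>I. c k * (g k x \<bullet> h))) (at x)"
      using assms by (intro has_derivative_sum has_derivative_mult_right) (auto simp: C1_per_def)
    then show ?thesis by (simp add: inner_sum_left)
  qed
qed

lemma C1_per_lincomb:
  assumes "C1_per f g" "C1_per f' g'"
  shows "C1_per (\<lambda>x. a * f x + b * f' x) (\<lambda>x. a *\<^sub>R g x + b *\<^sub>R g' x)"
  using C1_per_sum[of "UNIV :: bool set" "\<lambda>k. if k then f else f'" "\<lambda>k. if k then g else g'" "\<lambda>k. if k then a else b"] assms
  by (simp add: UNIV_bool add.commute)

lemma C1_gradient_continuous:
  fixes g :: "'a::euclidean_space \<Rightarrow> 'a"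
  assumes "\<forall>b\<in>Basis. Ck_on k S (\<lambda>x. g x \<bullet> b)"
  shows "continuous_on S g"
  using assms by (subst continuous_on_componentwise) (auto intro: Ck_on_continuous)

lemma smooth_periodic_C1_per:
  assumes "smooth_on UNIV \<phi>" "periodic \<phi>"
  obtains g where "C1_per \<phi> g" "\<And>x i. frechet_derivative \<phi> (at x) (axis i 1) = g x $ i"
proof -
  have "Ck_on (Suc 0) UNIV \<phi>" using assms unfolding smooth_on_def by blast
  then obtain g where g: "\<And>x. (\<phi> has_derivative (\<lambda>h. g x \<bullet> h)) (at x)"
    "\<forall>b\<in>Basis. Ck_on 0 UNIV (\<lambda>x. g x \<bullet> b)" by auto
  have "C1_per \<phi> g" unfolding C1_per_def using g C1_gradient_continuous assms by blast
  moreover have "frechet_derivative \<phi> (at x) (axis i 1) = g x $ i" for x i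
    using frechet_derivative_at[OF g(1)[of x]] by (metis inner_axis inner_real_def mult.right_neutral)
  ultimately show ?thesis using that by blast
qed

text \<open>Integration by parts: the boundary terms cancel because the gradient of the product of two
  periodic functions has integral zero.\<close>

lemma C1_per_has_weak_grad:
  assumes f: "C1_per f g"
  shows "has_weak_grad f g"
  unfolding has_weak_grad_def
proof (intro conjI allI impI)
  note c = C1_per_continuous[OF f]
  show "g \<in> borel_measurable torus" using c by (intro borel_measurable_torus_continuous)
  show "integrable torus (\<lambda>x. (norm (g x))\<^sup>2)"
    using c by (intro integrable_torus_continuous continuous_intros)
  fix \<phi> :: "real^'a \<Rightarrow> real" and i assume "smooth_on UNIV \<phi> \<and> periodic \<phi>"
  then obtain g' where g': "C1_per \<phi> g'" "\<And>x i. frechet_derivative \<phi> (at x) (axis i 1) = g' x $ i"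
    using smooth_periodic_C1_per by metis
  note c' = C1_per_continuous[OF g'(1)]
  have "(LINT x|torus. \<phi> x * g x $ i + f x * g' x $ i) = 0"
    using C1_per_integral_grad[OF C1_per_mult[OF f g'(1)], of i] by simp
  moreover have "(LINT x|torus. \<phi> x * g x $ i + f x * g' x $ i)
      = (LINT x|torus. \<phi> x * g x $ i) + (LINT x|torus. f x * g' x $ i)"
    using c c' by (intro Bochner_Integration.integral_add integrable_torus_continuous continuous_intros)
  ultimately show "(LINT x|torus. f x * frechet_derivative \<phi> (at x) (axis i 1)) = - (LINT x|torus. g x $ i * \<phi> x)"
    by (simp add: g' mult.commute)
qed

text \<open>The weak gradient in the definitions is chosen arbitrarily; for these functions it is the classical
  one almost everywhere.\<close>

lemma C1_per_weak_grad:
  assumes f: "C1_per f g"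
  shows "AE x in torus. weak_grad f x = g x" "weak_grad f \<in> borel_measurable torus"
proof -
  have "has_weak_grad f (weak_grad f)"
    unfolding weak_grad_def by (rule someI[of "has_weak_grad f", OF C1_per_has_weak_grad[OF f]])
  then show "AE x in torus. weak_grad f x = g x" "weak_grad f \<in> borel_measurable torus"
    using has_weak_grad_unique[OF _ C1_per_has_weak_grad[OF f]] by (blast, simp add: has_weak_grad_def)
qed

lemma C1_per_H_space:
  assumes "C1_per f g" "(LINT x|torus. f x) = 0"
  shows "f \<in> H_space"
  using assms C1_per_continuous[OF assms(1)] C1_per_has_weak_grad[OF assms(1)]
  unfolding H_space_def H1_per_def
  by (auto simp: C1_per_def intro!: borel_measurable_torus_continuous integrable_torus_continuous continuous_intros)

lemma C1_per_H_inner: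
  assumes f: "C1_per f g" and f': "C1_per f' g'"
  shows "H_inner f f' = (LINT x|torus. f x * f' x + g x \<bullet> g' x)"
  unfolding H_inner_def
proof (rule integral_cong_AE)
  note c = C1_per_continuous[OF f] C1_per_continuous[OF f']
  show "(\<lambda>x. f x * f' x + g x \<bullet> g' x) \<in> borel_measurable torus"
    by (intro borel_measurable_torus_continuous continuous_intros c)
  show "(\<lambda>x. f x * f' x + weak_grad f x \<bullet> weak_grad f' x) \<in> borel_measurable torus"
    by (intro borel_measurable_add borel_measurable_times borel_measurable_inner
        borel_measurable_torus_continuous c C1_per_weak_grad(2)[OF f] C1_per_weak_grad(2)[OF f'])
  show "AE x in torus. f x * f' x + weak_grad f x \<bullet> weak_grad f' x = f x * f' x + g x \<bullet> g' x"
    using C1_per_weak_grad(1)[OF f] C1_per_weak_grad(1)[OF f'] by eventually_elim simp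
qed

section \<open>The energy inner product on linear combinations\<close>

lemma C1_per_H_inner_integrable:
  assumes "C1_per f g" "C1_per f' g'"
  shows "integrable torus (\<lambda>x. f x * f' x + g x \<bullet> g' x)"
  using C1_per_continuous[OF assms(1)] C1_per_continuous[OF assms(2)]
  by (intro integrable_torus_continuous continuous_intros)

lemma H_inner_commute: "H_inner f g = H_inner g f"
  unfolding H_inner_def by (simp add: mult.commute inner_commute)

lemma H_inner_sum_left:
  assumes f: "\<And>k. k \<in> I \<Longrightarrow> C1_per (f k) (g k)" and h: "C1_per h g'"
  shows "H_inner (\<lambda>x. \<Sum>k\<in>I. c k * f k x) h = (\<Sum>k\<in>I. c k * H_inner (f k) h)"
proof -
  have "H_inner (\<lambda>x. \<Sum>k\<in>I. c k * f k x) h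
      = (LINT x|torus. (\<Sum>k\<in>I. c k * f k x) * h x + (\<Sum>k\<in>I. c k *\<^sub>R g k x) \<bullet> g' x)"
    by (rule C1_per_H_inner[OF C1_per_sum[OF f] h])
  also have "\<dots> = (LINT x|torus. (\<Sum>k\<in>I. c k * (f k x * h x + g k x \<bullet> g' x)))"
    by (simp add: sum_distrib_right inner_sum_left sum.distrib distrib_left mult.assoc)
  also have "\<dots> = (\<Sum>k\<in>I. LINT x|torus. c k * (f k x * h x + g k x \<bullet> g' x))"
    by (intro Bochner_Integration.integral_sum integrable_mult_right C1_per_H_inner_integrable f h)
  also have "\<dots> = (\<Sum>k\<in>I. c k * H_inner (f k) h)"
    using C1_per_H_inner[OF f h] by (intro sum.cong) auto
  finally show ?thesis .
qed

lemma H_inner_lincomb_left: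
  assumes "C1_per f g" "C1_per f' g'" "C1_per h k"
  shows "H_inner (\<lambda>x. a * f x + b * f' x) h = a * H_inner f h + b * H_inner f' h"
  using H_inner_sum_left[of "UNIV :: bool set" "\<lambda>k. if k then f else f'" "\<lambda>k. if k then g else g'" h k
      "\<lambda>k. if k then a else b"] assms
  by (simp add: UNIV_bool add.commute)

lemma H_inner_self_nonneg: "C1_per f g \<Longrightarrow> 0 \<le> H_inner f f"
  by (simp add: C1_per_H_inner integral_nonneg_AE)

section \<open>Homogeneous linear systems\<close>

text \<open>A homogeneous linear system with more unknowns than equations, by Gaussian elimination.\<close>

lemma homogeneous_system_nontrivial_solution:
  fixes c :: "'l \<Rightarrow> 'j \<Rightarrow> real"
  assumes "finite J" "finite L" "card J < card L"
  shows "\<exists>a. (\<exists>l\<in>L. a l \<noteq> 0) \<and> (\<forall>j\<in>J. (\<Sum>l\<in>L. a l * c l j) = 0)"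
  using assms
proof (induction J arbitrary: L c rule: finite_induct)
  case empty
  then have "L \<noteq> {}" by auto
  then show ?case by (intro exI[of _ "\<lambda>_. 1"]) auto
next
  case (insert j J)
  show ?case
  proof (cases "\<forall>l\<in>L. c l j = 0")
    case True
    have "card J < card L" using insert by simp
    from insert.IH[OF insert.prems(1) this, of c] show ?thesis using True by auto
  next
    case False
    then obtain l0 where l0: "l0 \<in> L" "c l0 j \<noteq> 0" by auto
    define L' where "L' = L - {l0}"
    have L': "finite L'" "l0 \<notin> L'" "L = insert l0 L'" using insert.prems l0 by (auto simp: L'_def)
    have "card J < card L'" using insert.prems insert.hyps L' by simp
    from insert.IH[OF L'(1) this, of "\<lambda>l i. c l i - c l j / c l0 j * c l0 i"] obtain a where
      a: "\<exists>l\<in>L'. a l \<noteq> 0" "\<And>i. i \<in> J \<Longrightarrow> (\<Sum>l\<in>L'. a l * (c l i - c l j / c l0 j * c l0 i)) = 0"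
      by blast
    \<comment> \<open>Equation \<open>j\<close> determines the unknown \<open>l0\<close> from the remaining ones.\<close>
    define s where "s = (\<Sum>l\<in>L'. a l * c l j) / c l0 j"
    define b where "b = a(l0 := - s)"
    have sum: "(\<Sum>l\<in>L. b l * c l i) = (\<Sum>l\<in>L'. a l * c l i) - s * c l0 i" for i
    proof -
      have "(\<Sum>l\<in>L'. b l * c l i) = (\<Sum>l\<in>L'. a l * c l i)"
        using L' by (intro sum.cong) (auto simp: b_def)
      then show ?thesis using L' by (simp add: b_def)
    qed
    have "(\<Sum>l\<in>L. b l * c l i) = 0" if "i \<in> J" for i
    proof -
      have "(\<Sum>l\<in>L'. a l * (c l i - c l j / c l0 j * c l0 i))
          = (\<Sum>l\<in>L'. a l * c l i - (a l * c l j) * (c l0 i / c l0 j))"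
        by (intro sum.cong) (auto simp: algebra_simps)
      also have "\<dots> = (\<Sum>l\<in>L'. a l * c l i) - s * c l0 i"
        by (simp add: sum_subtractf s_def sum_distrib_right sum_divide_distrib)
      finally show ?thesis using sum a(2)[OF that] by simp
    qed
    moreover have "(\<Sum>l\<in>L. b l * c l j) = 0"
      using sum[of j] l0 by (simp add: s_def)
    moreover have "\<exists>l\<in>L. b l \<noteq> 0" using a(1) L' by (force simp: b_def)
    ultimately show ?thesis by (intro exI[of _ b]) auto
  qed
qed

section \<open>Proper orthogonal decomposition\<close>

text \<open>The POD mode of an eigenvector before normalization.\<close>

definition pod_comb :: "nat \<Rightarrow> (nat \<Rightarrow> real ^ 'n \<Rightarrow> real) \<Rightarrow> real Matrix.vec \<Rightarrow> real ^ 'n \<Rightarrow> real" where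
  "pod_comb N y w x = (\<Sum>j<N. vec_index w j * y j x)"

lemma sorted_eigensystem_carrier:
  assumes "sorted_eigensystem N (corr_matrix N y) \<mu> v" "l \<in> {1..N}"
  shows "v l \<in> carrier_vec N"
  using assms by (auto simp: sorted_eigensystem_def eigenvector_def corr_matrix_def)

lemma sorted_eigensystem_orthonormal:
  assumes "sorted_eigensystem N (corr_matrix N y) \<mu> v" "k \<in> {1..N}" "l \<in> {1..N}"
  shows "(\<Sum>i<N. vec_index (v k) i * vec_index (v l) i) = (if k = l then 1 else 0)"
proof -
  have "scalar_prod (v k) (v l) = (if k = l then 1 else 0)"
    using assms unfolding sorted_eigensystem_def by blast
  moreover have "dim_vec (v l) = N" using sorted_eigensystem_carrier[OF assms(1,3)] by auto
  ultimately show ?thesis by (simp add: scalar_prod_def atLeast0LessThan)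
qed

text \<open>A square matrix with orthonormal rows has orthonormal columns.\<close>

lemma sorted_eigensystem_complete:
  assumes e: "sorted_eigensystem N (corr_matrix N y) \<mu> v" and ij: "i < N" "j < N"
  shows "(\<Sum>l\<in>{1..N}. vec_index (v l) i * vec_index (v l) j) = (if i = j then 1 else 0)"
proof -
  define A where "A = Matrix.mat N N (\<lambda>(l, i). vec_index (v (Suc l)) i)"
  have A: "A \<in> carrier_mat N N" "transpose_mat A \<in> carrier_mat N N" by (auto simp: A_def)
  have "A * transpose_mat A = 1\<^sub>m N"
  proof (rule eq_matI)
    fix k l assume "k < dim_row (1\<^sub>m N :: real Matrix.mat)" "l < dim_col (1\<^sub>m N :: real Matrix.mat)"
    then have kl: "k < N" "l < N" by auto
    then have "(A * transpose_mat A) $$ (k, l) = (\<Sum>i<N. vec_index (v (Suc k)) i * vec_index (v (Suc l)) i)"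
      by (simp add: A_def times_mat_def scalar_prod_def atLeast0LessThan)
    also have "\<dots> = (if k = l then 1 else 0)"
      using sorted_eigensystem_orthonormal[OF e, of "Suc k" "Suc l"] kl by simp
    finally show "(A * transpose_mat A) $$ (k, l) = 1\<^sub>m N $$ (k, l)" using kl by simp
  qed (auto simp: A_def)
  then have "transpose_mat A * A = 1\<^sub>m N" by (rule mat_mult_left_right_inverse[OF A])
  then have "(transpose_mat A * A) $$ (i, j) = (if i = j then 1 else 0)" using ij by simp
  moreover have "(transpose_mat A * A) $$ (i, j) = (\<Sum>l<N. vec_index (v (Suc l)) i * vec_index (v (Suc l)) j)"
    using ij by (simp add: A_def times_mat_def scalar_prod_def atLeast0LessThan)
  moreover have "\<dots> = (\<Sum>l\<in>{1..N}. vec_index (v l) i * vec_index (v l) j)"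
    by (rule sum.reindex_bij_witness[of _ "\<lambda>l. l - 1" Suc]) auto
  ultimately show ?thesis by simp
qed

text \<open>The eigenvalue equation, with the factor \<open>1 / N\<close> of the correlation matrix cleared.\<close>

lemma sorted_eigensystem_eq:
  assumes e: "sorted_eigensystem N (corr_matrix N y) \<mu> v" and l: "l \<in> {1..N}" and i: "i < N"
  shows "(\<Sum>j<N. vec_index (v l) j * H_inner (y i) (y j)) = real N * \<mu> l * vec_index (v l) i"
proof -
  have v: "v l \<in> carrier_vec N" by (rule sorted_eigensystem_carrier[OF e l])
  have "eigenvector (corr_matrix N y) (v l) (\<mu> l)"
    using e l unfolding sorted_eigensystem_def by auto
  then have "mult_mat_vec (corr_matrix N y) (v l) = smult_vec (\<mu> l) (v l)"
    unfolding eigenvector_def by auto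
  then have "vec_index (mult_mat_vec (corr_matrix N y) (v l)) i = vec_index (smult_vec (\<mu> l) (v l)) i"
    by simp
  then have "(\<Sum>j<N. 1 / real N * H_inner (y i) (y j) * vec_index (v l) j) = \<mu> l * vec_index (v l) i"
    using v i by (simp add: corr_matrix_def scalar_prod_def atLeast0LessThan)
  moreover have "(\<Sum>j<N. 1 / real N * H_inner (y i) (y j) * vec_index (v l) j)
      = 1 / real N * (\<Sum>j<N. vec_index (v l) j * H_inner (y i) (y j))"
    unfolding sum_distrib_left by (intro sum.cong) auto
  ultimately show ?thesis using i by (simp add: field_simps)
qed

text \<open>Snapshots \<open>y 0, \<dots>, y (N - 1)\<close> with gradients \<open>gy\<close>, and an eigensystem of their correlation matrix.
  Below, \<open>e l i\<close> is component \<open>i\<close> of the eigenvector \<open>v l\<close>, and \<open>f l\<close> is its unnormalized POD mode.\<close>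

locale pod_system =
  fixes N :: nat and y :: "nat \<Rightarrow> real ^ 'n \<Rightarrow> real" and gy :: "nat \<Rightarrow> real ^ 'n \<Rightarrow> real ^ 'n"
    and \<mu> :: "nat \<Rightarrow> real" and v :: "nat \<Rightarrow> real Matrix.vec"
  assumes C1: "\<And>i. i < N \<Longrightarrow> C1_per (y i) (gy i)"
    and eig: "sorted_eigensystem N (corr_matrix N y) \<mu> v"
begin

abbreviation e :: "nat \<Rightarrow> nat \<Rightarrow> real" where "e l i \<equiv> vec_index (v l) i"

abbreviation f :: "nat \<Rightarrow> real ^ 'n \<Rightarrow> real" where "f l \<equiv> pod_comb N y (v l)"

abbreviation gf :: "nat \<Rightarrow> real ^ 'n \<Rightarrow> real ^ 'n" where "gf l \<equiv> (\<lambda>x. \<Sum>j<N. e l j *\<^sub>R gy j x)"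

lemma C1_f: "C1_per (f l) (gf l)"
  unfolding pod_comb_def[abs_def] by (intro C1_per_sum C1) auto

lemma H_inner_snapshot_f:
  assumes "l \<in> {1..N}" "i < N"
  shows "H_inner (f l) (y i) = real N * \<mu> l * e l i"
proof -
  have "H_inner (f l) (y i) = (\<Sum>j<N. e l j * H_inner (y j) (y i))"
    unfolding pod_comb_def[abs_def] using C1 assms by (intro H_inner_sum_left) auto
  then show ?thesis using sorted_eigensystem_eq[OF eig assms] by (simp add: H_inner_commute)
qed

text \<open>The unnormalized modes are orthogonal, with squared norms \<open>N * \<mu> l\<close>.\<close>

lemma H_inner_f:
  assumes kl: "k \<in> {1..N}" "l \<in> {1..N}"
  shows "H_inner (f k) (f l) = (if k = l then real N * \<mu> l else 0)"
proof -
  have "H_inner (f k) (f l) = (\<Sum>i<N. e k i * H_inner (y i) (f l))"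
    using C1_f[of l] C1 unfolding pod_comb_def[where w = "v k", abs_def]
    by (intro H_inner_sum_left) auto
  also have "\<dots> = (\<Sum>i<N. e k i * (real N * \<mu> l * e l i))"
    using H_inner_snapshot_f[OF kl(2)] by (intro sum.cong) (auto simp: H_inner_commute)
  also have "\<dots> = real N * \<mu> l * (\<Sum>i<N. e k i * e l i)"
    unfolding sum_distrib_left by (intro sum.cong) auto
  finally show ?thesis using sorted_eigensystem_orthonormal[OF eig kl] by simp
qed

lemma eigenvalue_nonneg:
  assumes "l \<in> {1..N}"
  shows "0 \<le> \<mu> l"
  using H_inner_f[OF assms assms] H_inner_self_nonneg[OF C1_f[of l]] assms
  by (auto simp: zero_le_mult_iff)

lemma eigenvalue_mono: "1 \<le> j \<Longrightarrow> j \<le> k \<Longrightarrow> k \<le> N \<Longrightarrow> \<mu> k \<le> \<mu> j"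
  using eig unfolding sorted_eigensystem_def by auto

lemma snapshot_expansion:
  assumes "i < N"
  shows "y i x = (\<Sum>l\<in>{1..N}. e l i * f l x)"
proof -
  have "(\<Sum>l\<in>{1..N}. e l i * f l x) = (\<Sum>j<N. (\<Sum>l\<in>{1..N}. e l i * e l j) * y j x)"
    unfolding pod_comb_def sum_distrib_left sum_distrib_right
    by (subst sum.swap) (simp add: mult.assoc)
  also have "\<dots> = (\<Sum>j<N. if i = j then y j x else 0)"
    using sorted_eigensystem_complete[OF eig assms] by (intro sum.cong) auto
  finally show ?thesis using assms by simp
qed

text \<open>The modes of positive eigenvalues have positive norm, so the normalization does not affect the span.\<close>

lemma pod_space_eq:
  assumes r: "r \<le> N"
  shows "pod_space N y \<mu> v r = {u. \<exists>c. u = (\<lambda>x. \<Sum>k\<in>{k\<in>{1..r}. \<mu> k > 0}. c k * f k x)}"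
proof -
  let ?R = "{k\<in>{1..r}. \<mu> k > 0}"
  have n: "H_norm (f k) > 0" if "k \<in> ?R" for k
    using that r H_inner_f[of k k] by (auto simp: H_norm_def)
  have m: "pod_mode N y (v k) x = f k x / H_norm (f k)" for k x
    by (simp add: pod_mode_def pod_comb_def[abs_def])
  show ?thesis
  proof (intro equalityI subsetI)
    fix u assume "u \<in> pod_space N y \<mu> v r"
    then obtain c where "u = (\<lambda>x. \<Sum>k\<in>?R. c k * pod_mode N y (v k) x)"
      by (auto simp: pod_space_def)
    then have "u = (\<lambda>x. \<Sum>k\<in>?R. (c k / H_norm (f k)) * f k x)" by (simp add: m)
    then show "u \<in> {u. \<exists>c. u = (\<lambda>x. \<Sum>k\<in>?R. c k * f k x)}" by (intro CollectI exI)
  next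
    fix u assume "u \<in> {u. \<exists>c. u = (\<lambda>x. \<Sum>k\<in>?R. c k * f k x)}"
    then obtain c where "u = (\<lambda>x. \<Sum>k\<in>?R. c k * f k x)" by auto
    then have "u = (\<lambda>x. \<Sum>k\<in>?R. (c k * H_norm (f k)) * pod_mode N y (v k) x)"
      using n by (auto simp: m fun_eq_iff intro!: sum.cong) (metis less_irrefl)
    then show "u \<in> pod_space N y \<mu> v r" unfolding pod_space_def by (intro CollectI exI)
  qed
qed

text \<open>If all snapshots are combinations of \<open>card J\<close> functions, at most \<open>card J\<close> eigenvalues are nonzero:
  otherwise the modes of \<open>l > card J\<close> positive eigenvalues would be linearly dependent, although they
  are orthogonal and nonzero.\<close>

lemma eigenvalue_zero_beyond_rank:
  assumes span: "\<And>i x. i < N \<Longrightarrow> y i x = (\<Sum>j\<in>J. B i j * z j x)"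
    and J: "finite J" and l: "card J < l" "l \<le> N"
  shows "\<mu> l = 0"
proof (rule ccontr)
  assume "\<mu> l \<noteq> 0"
  then have pos: "\<mu> k > 0" if "k \<in> {1..l}" for k
    using eigenvalue_nonneg[of l] eigenvalue_mono[of k l] that l by force
  have f: "f k x = (\<Sum>j\<in>J. (\<Sum>i<N. e k i * B i j) * z j x)" for k x
  proof -
    have "f k x = (\<Sum>i<N. \<Sum>j\<in>J. e k i * B i j * z j x)"
      unfolding pod_comb_def using span by (simp add: sum_distrib_left mult.assoc)
    then show ?thesis by (subst (asm) sum.swap) (simp add: sum_distrib_right)
  qed
  obtain a where a: "\<exists>k\<in>{1..l}. a k \<noteq> 0"
    "\<And>j. j \<in> J \<Longrightarrow> (\<Sum>k\<in>{1..l}. a k * (\<Sum>i<N. e k i * B i j)) = 0"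
    using homogeneous_system_nontrivial_solution[of J "{1..l}" "\<lambda>k j. \<Sum>i<N. e k i * B i j"] J l by auto
  then obtain k0 where k0: "k0 \<in> {1..l}" "a k0 \<noteq> 0" by blast
  have zero: "(\<lambda>x. \<Sum>k\<in>{1..l}. a k * f k x) = (\<lambda>x. \<Sum>k\<in>{}. a k * f k x)"
  proof
    fix x
    have "(\<Sum>k\<in>{1..l}. a k * f k x) = (\<Sum>k\<in>{1..l}. \<Sum>j\<in>J. a k * (\<Sum>i<N. e k i * B i j) * z j x)"
      by (simp add: f sum_distrib_left[of "a _" _ J] mult.assoc)
    also have "\<dots> = (\<Sum>j\<in>J. \<Sum>k\<in>{1..l}. a k * (\<Sum>i<N. e k i * B i j) * z j x)"
      by (rule sum.swap)
    also have "\<dots> = (\<Sum>j\<in>J. (\<Sum>k\<in>{1..l}. a k * (\<Sum>i<N. e k i * B i j)) * z j x)"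
      by (simp only: sum_distrib_right)
    finally show "(\<Sum>k\<in>{1..l}. a k * f k x) = (\<Sum>k\<in>{}. a k * f k x)" using a(2) by simp
  qed
  have "H_inner (\<lambda>x. \<Sum>k\<in>{1..l}. a k * f k x) (f k0) = (\<Sum>k\<in>{1..l}. a k * H_inner (f k) (f k0))"
    by (rule H_inner_sum_left[OF C1_f C1_f])
  also have "\<dots> = (\<Sum>k\<in>{1..l}. if k = k0 then a k0 * (real N * \<mu> k0) else 0)"
    using k0 l by (intro sum.cong) (auto simp: H_inner_f)
  also have "\<dots> = a k0 * (real N * \<mu> k0)" using k0 by simp
  finally have "a k0 * (real N * \<mu> k0) = 0"
    unfolding zero by (subst (asm) H_inner_sum_left[OF C1_f C1_f]) simp
  then show False using k0 pos[of k0] l by auto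
qed

text \<open>The \<open>H\<close>-orthogonal projection of snapshot \<open>i\<close> onto the POD space, written through its coefficients in
  the unnormalized modes. These are components of eigenvectors, by \<open>snapshot_expansion\<close>.\<close>

definition pod_proj :: "nat \<Rightarrow> nat \<Rightarrow> real ^ 'n \<Rightarrow> real" where
  "pod_proj r i x = (\<Sum>k\<in>{k\<in>{1..r}. \<mu> k > 0}. e k i * f k x)"

lemma pod_proj_mem: "r \<le> N \<Longrightarrow> pod_proj r i \<in> pod_space N y \<mu> v r"
  unfolding pod_proj_def[abs_def] by (simp only: pod_space_eq) (intro CollectI exI, rule refl)

text \<open>Linear relations between snapshots pass to their projections, since \<open>N * \<mu> l * e l i\<close> is the inner
  product of snapshot \<open>i\<close> with \<open>f l\<close>.\<close>

lemma pod_proj_lincomb: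
  assumes r: "r \<le> N" and ij: "i < N" "j < N" "k < N"
    and rel: "\<And>x. y i x = a * y j x + b * y k x"
  shows "pod_proj r i x = a * pod_proj r j x + b * pod_proj r k x"
proof -
  have "e l i = a * e l j + b * e l k" if "l \<in> {k\<in>{1..r}. \<mu> k > 0}" for l
  proof -
    have l: "l \<in> {1..N}" "\<mu> l > 0" using that r by auto
    have "y i = (\<lambda>x. a * y j x + b * y k x)" using rel by auto
    then have "H_inner (y i) (f l) = a * H_inner (y j) (f l) + b * H_inner (y k) (f l)"
      using H_inner_lincomb_left[OF C1[OF ij(2)] C1[OF ij(3)] C1_f] by simp
    then have "real N * \<mu> l * e l i = real N * \<mu> l * (a * e l j + b * e l k)"
      using H_inner_snapshot_f[OF l(1)] ij by (simp add: H_inner_commute algebra_simps)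
    then show ?thesis using l ij by simp
  qed
  then have "pod_proj r i x = (\<Sum>l\<in>{k\<in>{1..r}. \<mu> k > 0}. (a * e l j + b * e l k) * f l x)"
    unfolding pod_proj_def by (intro sum.cong) auto
  then show ?thesis
    by (simp add: pod_proj_def distrib_right sum.distrib sum_distrib_left mult.assoc)
qed

text \<open>The mean square projection error of the snapshots is the sum of the discarded eigenvalues. A nonpositive eigenvalue among
  the first \<open>r\<close> is zero and does not contribute.\<close>

lemma pod_proj_error:
  assumes r: "r \<le> N"
  shows "(\<Sum>i<N. H_inner (\<lambda>x. y i x - pod_proj r i x) (\<lambda>x. y i x - pod_proj r i x))
    = real N * (\<Sum>l\<in>{r+1..N}. \<mu> l)"
proof -
  let ?R = "{k\<in>{1..r}. \<mu> k > 0}"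
  let ?Q = "{1..N} - ?R"
  have R: "?R \<subseteq> {1..N}" "finite {1..N}" using r by auto
  have err: "(\<lambda>x. y i x - pod_proj r i x) = (\<lambda>x. \<Sum>l\<in>?Q. e l i * f l x)" if "i < N" for i
    unfolding pod_proj_def snapshot_expansion[OF that] by (simp only: sum_diff[OF R(2,1)])
  have "H_inner (\<lambda>x. \<Sum>l\<in>?Q. e l i * f l x) (\<lambda>x. \<Sum>l\<in>?Q. e l i * f l x)
      = (\<Sum>l\<in>?Q. real N * \<mu> l * (e l i * e l i))" for i
  proof -
    have "H_inner (\<lambda>x. \<Sum>l\<in>?Q. e l i * f l x) (\<lambda>x. \<Sum>l\<in>?Q. e l i * f l x)
        = (\<Sum>l\<in>?Q. e l i * H_inner (f l) (\<lambda>x. \<Sum>k\<in>?Q. e k i * f k x))"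
      by (rule H_inner_sum_left[OF C1_f C1_per_sum[OF C1_f]])
    also have "\<dots> = (\<Sum>l\<in>?Q. e l i * (\<Sum>k\<in>?Q. e k i * H_inner (f k) (f l)))"
      by (subst H_inner_commute, subst H_inner_sum_left[OF C1_f C1_f]) (rule refl)
    also have "\<dots> = (\<Sum>l\<in>?Q. e l i * (\<Sum>k\<in>?Q. if k = l then e l i * (real N * \<mu> l) else 0))"
      by (intro sum.cong refl arg_cong2[of _ _ _ _ "(*)"]) (auto simp: H_inner_f)
    also have "\<dots> = (\<Sum>l\<in>?Q. real N * \<mu> l * (e l i * e l i))"
      by (intro sum.cong) auto
    finally show ?thesis .
  qed
  then have "(\<Sum>i<N. H_inner (\<lambda>x. y i x - pod_proj r i x) (\<lambda>x. y i x - pod_proj r i x))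
      = (\<Sum>i<N. \<Sum>l\<in>?Q. real N * \<mu> l * (e l i * e l i))"
    by (intro sum.cong) (simp_all add: err)
  also have "\<dots> = (\<Sum>l\<in>?Q. real N * \<mu> l * (\<Sum>i<N. e l i * e l i))"
    by (subst sum.swap) (simp add: sum_distrib_left)
  also have "\<dots> = (\<Sum>l\<in>?Q. real N * \<mu> l)"
    using sorted_eigensystem_orthonormal[OF eig] by (intro sum.cong) auto
  also have "\<dots> = (\<Sum>l\<in>{r+1..N}. real N * \<mu> l)"
  proof (rule sum.mono_neutral_right)
    show "\<forall>l\<in>?Q - {r + 1..N}. real N * \<mu> l = 0"
    proof
      fix l assume l: "l \<in> ?Q - {r + 1..N}"
      then have "l \<in> {1..N}" "\<not> \<mu> l > 0" by auto
      then show "real N * \<mu> l = 0" using eigenvalue_nonneg[of l] by simp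
    qed
  qed auto
  finally show ?thesis by (simp add: sum_distrib_left)
qed

end

section \<open>Regularity in time\<close>

text \<open>Smoothness on the closed space-time slab is used in this form: classical derivatives in space and
  time, and first-order consistency of the backward difference quotient, uniformly on the unit cube,
  by the mean value theorem applied twice.\<close>

lemma smooth_in_time:
  fixes u :: "real \<Rightarrow> real ^ 'n \<Rightarrow> real"
  assumes T: "T > 0" and smooth: "smooth_on (UNIV \<times> {0..T}) (\<lambda>(x, t). u t x)"
  obtains G ut M where
    "\<And>t. t \<in> {0..T} \<Longrightarrow> continuous_on UNIV (G t)"
    "\<And>t x. t \<in> {0..T} \<Longrightarrow> (u t has_derivative (\<lambda>h. G t x \<bullet> h)) (at x)"
    "\<And>t. t \<in> {0..T} \<Longrightarrow> continuous_on UNIV (ut t)"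
    "\<And>t x. t \<in> {0..T} \<Longrightarrow> vector_derivative (\<lambda>s. u s x) (at t within {0..T}) = ut t x"
    "\<And>x s t. x \<in> cbox 0 1 \<Longrightarrow> 0 \<le> s \<Longrightarrow> s < t \<Longrightarrow> t \<le> T \<Longrightarrow>
       \<bar>ut t x - (u t x - u s x) / (t - s)\<bar> \<le> M * (t - s)"
proof -
  define S where "S = (UNIV :: (real^'n) set) \<times> {0..T}"
  define b0 where "b0 = (0 :: real^'n, 1 :: real)"
  have b0: "b0 \<in> Basis" by (simp add: b0_def Basis_prod_def)
  have "Ck_on (Suc (Suc 0)) S (\<lambda>(x, t). u t x)"
    using smooth unfolding smooth_on_def S_def by blast
  then obtain g where g: "\<And>z. z \<in> S \<Longrightarrow> ((\<lambda>(x, t). u t x) has_derivative (\<lambda>h. g z \<bullet> h)) (at z within S)"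
    "\<forall>b\<in>Basis. Ck_on (Suc 0) S (\<lambda>z. g z \<bullet> b)"
    unfolding Ck_on.simps(2)[of "Suc 0"] by blast
  have "Ck_on (Suc 0) S (\<lambda>z. g z \<bullet> b0)" using g(2) b0 by blast
  then obtain g2 where g2: "\<And>z. z \<in> S \<Longrightarrow> ((\<lambda>z. g z \<bullet> b0) has_derivative (\<lambda>h. g2 z \<bullet> h)) (at z within S)"
    "\<forall>b\<in>Basis. Ck_on 0 S (\<lambda>z. g2 z \<bullet> b)"
    unfolding Ck_on.simps(2) by blast
  have gc: "continuous_on S g" by (rule C1_gradient_continuous[OF g(2)])
  have g2c: "continuous_on S g2" by (rule C1_gradient_continuous[OF g2(2)])
  have sub: "(\<lambda>x. (x, t)) ` UNIV \<subseteq> S" if "t \<in> {0..T}" for t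
    using that by (auto simp: S_def)
  have slice: "continuous_on UNIV (\<lambda>x. g (x, t))" if "t \<in> {0..T}" for t
    by (rule continuous_on_compose2[OF gc _ sub[OF that]]) (intro continuous_intros)
  \<comment> \<open>Derivatives of a function on space-time along the time direction.\<close>
  have time: "((\<lambda>s. F (x, s)) has_derivative (\<lambda>h. (k \<bullet> b0) * h)) (at t within {a..b})"
    if "(F has_derivative (\<lambda>h. k \<bullet> h)) (at (x, t) within S)" "{a..b} \<subseteq> {0..T}"
    for F :: "(real^'n) \<times> real \<Rightarrow> real" and k x t a b
  proof -
    have "((\<lambda>s. (x, s)) has_derivative (\<lambda>h. (0, h))) (at t within {a..b})"
      by (auto intro!: derivative_eq_intros)
    moreover have "(F has_derivative (\<lambda>h. k \<bullet> h)) (at (x, t) within (\<lambda>s. (x, s)) ` {a..b})"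
      using that by (auto intro: has_derivative_subset simp: S_def)
    ultimately have "((\<lambda>s. F (x, s)) has_derivative (\<lambda>h. k \<bullet> (0, h))) (at t within {a..b})"
      by (rule has_derivative_in_compose)
    then show ?thesis by (simp add: b0_def inner_prod_def)
  qed
  define G where "G t x = fst (g (x, t))" for t x
  define ut where "ut t x = g (x, t) \<bullet> b0" for t x
  have "compact ((\<lambda>z. g2 z \<bullet> b0) ` (cbox 0 1 \<times> {0..T}))"
    by (intro compact_continuous_image compact_Times continuous_intros continuous_on_subset[OF g2c])
      (auto simp: S_def)
  then obtain M where M: "\<And>x t. x \<in> cbox 0 1 \<Longrightarrow> t \<in> {0..T} \<Longrightarrow> \<bar>g2 (x, t) \<bullet> b0\<bar> \<le> M"
    using compact_imp_bounded by (force simp: bounded_iff)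
  show ?thesis
  proof
    fix t x assume t: "t \<in> {0..T}"
    show "continuous_on UNIV (G t)" unfolding G_def by (intro continuous_intros slice[OF t])
    show "continuous_on UNIV (ut t)" unfolding ut_def by (intro continuous_intros slice[OF t])
    show "(u t has_derivative (\<lambda>h. G t x \<bullet> h)) (at x)"
    proof -
      have "((\<lambda>x. (x, t)) has_derivative (\<lambda>h. (h, 0))) (at x within UNIV)"
        by (auto intro!: derivative_eq_intros)
      moreover have "((\<lambda>(x, t). u t x) has_derivative (\<lambda>h. g (x, t) \<bullet> h)) (at (x, t) within (\<lambda>x. (x, t)) ` UNIV)"
        by (rule has_derivative_subset[OF g(1) sub[OF t]]) (use t in \<open>auto simp: S_def\<close>)
      ultimately have "((\<lambda>x. (\<lambda>(x, t). u t x) (x, t)) has_derivative (\<lambda>h. g (x, t) \<bullet> (h, 0))) (at x within UNIV)"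
        by (rule has_derivative_in_compose)
      then show ?thesis by (simp add: G_def inner_prod_def)
    qed
    have "((\<lambda>s. (\<lambda>(x, t). u t x) (x, s)) has_derivative (\<lambda>h. (g (x, t) \<bullet> b0) * h)) (at t within {0..T})"
      by (rule time[OF g(1)]) (use t in \<open>auto simp: S_def\<close>)
    then have "((\<lambda>s. u s x) has_vector_derivative ut t x) (at t within {0..T})"
      by (simp add: has_vector_derivative_def ut_def mult.commute)
    then show "vector_derivative (\<lambda>s. u s x) (at t within {0..T}) = ut t x"
      by (rule vector_derivative_within_closed_interval[OF T t])
  next
    fix x s t assume x: "x \<in> cbox (0::real^'n) 1" and st: "0 \<le> s" "s < t" "t \<le> T"
    have "((\<lambda>s. (\<lambda>(x, t). u t x) (x, s)) has_derivative (\<lambda>h. (g (x, z) \<bullet> b0) * h)) (at z within {s..t})"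
      if "s \<le> z" "z \<le> t" for z
      by (rule time[OF g(1)]) (use st that in \<open>auto simp: S_def\<close>)
    then obtain z where z: "z \<in> {s<..<t}" "u t x - u s x = ut z x * (t - s)"
      using mvt_simple[OF st(2), of "\<lambda>s. u s x" "\<lambda>z h. ut z x * h"] by (auto simp: ut_def)
    have zt: "z < t" using z by simp
    have "((\<lambda>s. g (x, s) \<bullet> b0) has_derivative (\<lambda>h. (g2 (x, w) \<bullet> b0) * h)) (at w within {z..t})"
      if "z \<le> w" "w \<le> t" for w
      by (rule time[OF g2(1)]) (use st z that in \<open>auto simp: S_def\<close>)
    then obtain w where w: "w \<in> {z<..<t}" "ut t x - ut z x = (g2 (x, w) \<bullet> b0) * (t - z)"
      using mvt_simple[OF zt, of "\<lambda>s. ut s x" "\<lambda>w h. (g2 (x, w) \<bullet> b0) * h"] by (auto simp: ut_def)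
    have Mw: "\<bar>g2 (x, w) \<bullet> b0\<bar> \<le> M" using M[OF x, of w] w z st by auto
    have "ut t x - (u t x - u s x) / (t - s) = (g2 (x, w) \<bullet> b0) * (t - z)"
      using z w st by simp
    also have "\<bar>\<dots>\<bar> \<le> M * (t - s)"
      unfolding abs_mult using Mw w z by (intro mult_mono) auto
    finally show "\<bar>ut t x - (u t x - u s x) / (t - s)\<bar> \<le> M * (t - s)" .
  qed
qed

section \<open>The energy estimate for one time step\<close>

lemma C1_per_diff:
  "C1_per f g \<Longrightarrow> C1_per f' g' \<Longrightarrow> C1_per (\<lambda>x. f x - f' x) (\<lambda>x. g x - g' x)"
  using C1_per_lincomb[of f g f' g' 1 "-1"] by simp

lemma form_a_C1_per:
  assumes u: "C1_per u gu" and w: "C1_per w gw" and V: "continuous_on UNIV V"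
  shows "form_a d Sl V u w = (LINT x|torus. (V x \<bullet> gu x) * w x + d * Sl * (gu x \<bullet> gw x))"
  unfolding form_a_def
proof (rule integral_cong_AE)
  note c = C1_per_continuous[OF u] C1_per_continuous[OF w]
  show "(\<lambda>x. (V x \<bullet> gu x) * w x + d * Sl * (gu x \<bullet> gw x)) \<in> borel_measurable torus"
    by (intro borel_measurable_torus_continuous continuous_intros c V)
  show "(\<lambda>x. (V x \<bullet> weak_grad u x) * w x + d * Sl * (weak_grad u x \<bullet> weak_grad w x)) \<in> borel_measurable torus"
    by (intro borel_measurable_add borel_measurable_times borel_measurable_inner borel_measurable_const
        borel_measurable_torus_continuous[OF V] borel_measurable_torus_continuous[OF c(3)]
        C1_per_weak_grad(2)[OF u] C1_per_weak_grad(2)[OF w])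
  show "AE x in torus. (V x \<bullet> weak_grad u x) * w x + d * Sl * (weak_grad u x \<bullet> weak_grad w x)
      = (V x \<bullet> gu x) * w x + d * Sl * (gu x \<bullet> gw x)"
    using C1_per_weak_grad(1)[OF u] C1_per_weak_grad(1)[OF w] by eventually_elim simp
qed

text \<open>The spatial average subtracted in \<open>F\<close> is invisible to mean-free test functions.\<close>

lemma L2_inner_form_F_C1_per:
  assumes u: "C1_per u gu" and w: "continuous_on UNIV w" "(LINT x|torus. w x) = 0"
  shows "L2_inner (form_F Sl P u) w = (LINT x|torus. Sl * norm (P + gu x) * w x)"
proof -
  note c = C1_per_continuous[OF u]
  define a where "a = (LINT y|torus. Sl * norm (P + weak_grad u y))"
  have "L2_inner (form_F Sl P u) w = (LINT x|torus. Sl * norm (P + gu x) * w x - a * w x)"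
    unfolding L2_inner_def form_F_def a_def[symmetric]
  proof (rule integral_cong_AE)
    show "(\<lambda>x. (Sl * norm (P + weak_grad u x) - a) * w x) \<in> borel_measurable torus"
      by (intro borel_measurable_diff borel_measurable_times borel_measurable_add borel_measurable_const
          borel_measurable_norm borel_measurable_torus_continuous[OF w(1)] C1_per_weak_grad(2)[OF u]
          measurable_compose[OF _ borel_measurable_norm])
    show "(\<lambda>x. Sl * norm (P + gu x) * w x - a * w x) \<in> borel_measurable torus"
      by (intro borel_measurable_torus_continuous continuous_intros c w)
    show "AE x in torus. (Sl * norm (P + weak_grad u x) - a) * w x = Sl * norm (P + gu x) * w x - a * w x"
      using C1_per_weak_grad(1)[OF u] by eventually_elim (simp add: algebra_simps)
  qed
  also have "\<dots> = (LINT x|torus. Sl * norm (P + gu x) * w x) - (LINT x|torus. a * w x)"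
    by (intro Bochner_Integration.integral_diff integrable_torus_continuous continuous_intros c w)
  finally show ?thesis using w(2) by simp
qed

lemma measure_torus: "measure torus (cbox 0 (1 :: real ^ 'n)) = 1"
proof -
  have "measure lborel (cbox 0 (1 :: real^'n)) = 1"
    by (subst content_cbox_cart) (auto simp: interval_ne_empty_cart)
  then have "(LINT x|(torus :: (real^'n) measure). (1::real)) = 1"
    by (subst integral_torus_eq) simp_all
  then show ?thesis by simp
qed

text \<open>Pointwise lower bound of the integrand in the energy identity. In the application, \<open>\<theta>\<close> and \<open>\<theta>'\<close> are the error components
  in the POD space at the new and the old time, \<open>p\<close> is the gradient of \<open>\<theta>\<close>, \<open>q\<close> the gradient of the projection
  error, and \<open>\<sigma>\<close>, \<open>\<tau>\<close> are the projection and the consistency error of the difference quotient. Young's inequality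
  absorbs every occurrence of \<open>norm p\<close> into the diffusion term \<open>\<kappa> * (norm p)\<^sup>2\<close>.\<close>

lemma pointwise_energy_bound:
  fixes p q V :: "'a::real_inner"
  assumes h: "h > 0" and k: "\<kappa> > 0" and Sl: "Sl \<ge> 0" and V: "norm V \<le> A" and n: "\<bar>n\<bar> \<le> norm (p - q)"
    and K: "K = (A + Sl)\<^sup>2 / (2 * \<kappa>) + (A + Sl)\<^sup>2 / 2 + \<kappa> / 2 + 1"
  shows "(\<theta>\<^sup>2 - \<theta>'\<^sup>2) / (2 * h) - K * \<theta>\<^sup>2 - K * ((norm q)\<^sup>2 + \<sigma>\<^sup>2 + \<tau>\<^sup>2)
    \<le> ((\<theta> - \<theta>') / h - \<sigma> - \<tau>) * \<theta> + (V \<bullet> (p - q)) * \<theta> + \<kappa> * ((p - q) \<bullet> p) + Sl * n * \<theta>"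
proof -
  define a b s B where "a = norm p" and "b = norm q" and "s = \<bar>\<theta>\<bar>" and "B = A + Sl"
  have nn: "0 \<le> a" "0 \<le> b" "0 \<le> s" "0 \<le> A" using order_trans[OF norm_ge_zero V] by (simp_all add: a_def b_def s_def)
  have pq: "norm (p - q) \<le> a + b" unfolding a_def b_def by (rule norm_triangle_ineq4)
  have 1: "- (A * (a + b) * s) \<le> (V \<bullet> (p - q)) * \<theta>"
  proof -
    have "\<bar>(V \<bullet> (p - q)) * \<theta>\<bar> \<le> (A * (a + b)) * s"
      unfolding abs_mult s_def
      by (intro mult_right_mono order_trans[OF Cauchy_Schwarz_ineq2] mult_mono V pq nn) auto
    then show ?thesis by linarith
  qed
  have 2: "- (Sl * (a + b) * s) \<le> Sl * n * \<theta>"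
  proof -
    have "\<bar>Sl * n * \<theta>\<bar> \<le> (Sl * (a + b)) * s"
      unfolding abs_mult s_def using Sl n pq by (intro mult_mono) auto
    then show ?thesis by linarith
  qed
  have 3: "\<kappa> * a\<^sup>2 - \<kappa> * (a * b) \<le> \<kappa> * ((p - q) \<bullet> p)"
  proof -
    have "q \<bullet> p \<le> a * b" using norm_cauchy_schwarz[of q p] by (simp add: a_def b_def mult.commute)
    then have "a\<^sup>2 - a * b \<le> (p - q) \<bullet> p"
      by (simp add: inner_diff_left a_def dot_square_norm)
    from mult_left_mono[OF this, of \<kappa>] k show ?thesis by (simp add: algebra_simps)
  qed
  have 4: "(\<theta>\<^sup>2 - \<theta>'\<^sup>2) / (2 * h) \<le> ((\<theta> - \<theta>') / h) * \<theta>"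
  proof -
    have "\<theta>\<^sup>2 - \<theta>'\<^sup>2 \<le> 2 * ((\<theta> - \<theta>') * \<theta>)"
      using zero_le_power2[of "\<theta> - \<theta>'"] by (simp add: power2_eq_square algebra_simps)
    then have "(\<theta>\<^sup>2 - \<theta>'\<^sup>2) / (2 * h) \<le> 2 * ((\<theta> - \<theta>') * \<theta>) / (2 * h)"
      using h by (intro divide_right_mono) auto
    then show ?thesis by simp
  qed
  have y: "x * z \<le> (x\<^sup>2 + z\<^sup>2) / 2" for x z :: real
    using zero_le_power2[of "x - z"] by (simp add: power2_diff)
  have 5: "\<sigma> * \<theta> \<le> (\<sigma>\<^sup>2 + \<theta>\<^sup>2) / 2" "\<tau> * \<theta> \<le> (\<tau>\<^sup>2 + \<theta>\<^sup>2) / 2" by (rule y)+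
  have 6: "B * b * s \<le> b\<^sup>2 / 2 + B\<^sup>2 / 2 * \<theta>\<^sup>2"
    using y[of b "B * s"] by (simp add: s_def power_mult_distrib algebra_simps)
  have 7: "\<kappa> * (a * b) \<le> \<kappa> / 2 * a\<^sup>2 + \<kappa> / 2 * b\<^sup>2"
    using mult_left_mono[OF y[of a b], of \<kappa>] k by (simp add: algebra_simps)
  have 8: "B * a * s \<le> \<kappa> / 2 * a\<^sup>2 + B\<^sup>2 / (2 * \<kappa>) * \<theta>\<^sup>2"
  proof -
    \<comment> \<open>Young's inequality weighted by \<open>\<kappa>\<close>.\<close>
    have "\<kappa> * (a * (B / \<kappa> * s)) \<le> \<kappa> * ((a\<^sup>2 + (B / \<kappa> * s)\<^sup>2) / 2)"
      using k by (intro mult_left_mono y) auto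
    moreover have "\<kappa> * (a * (B / \<kappa> * s)) = B * a * s" using k by simp
    moreover have "\<kappa> * ((a\<^sup>2 + (B / \<kappa> * s)\<^sup>2) / 2) = \<kappa> / 2 * a\<^sup>2 + B\<^sup>2 / (2 * \<kappa>) * \<theta>\<^sup>2"
      using k by (simp add: s_def power_mult_distrib power_divide field_simps power2_eq_square)
    ultimately show ?thesis by simp
  qed
  have 9: "1 / 2 * b\<^sup>2 + \<kappa> / 2 * b\<^sup>2 + \<sigma>\<^sup>2 / 2 + \<tau>\<^sup>2 / 2 \<le> K * (b\<^sup>2 + \<sigma>\<^sup>2 + \<tau>\<^sup>2)"
  proof -
    have "0 \<le> (A + Sl)\<^sup>2 / (2 * \<kappa>)" "0 \<le> (A + Sl)\<^sup>2 / 2" using k by auto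
    then have K1: "1 / 2 + \<kappa> / 2 \<le> K" "1 / 2 \<le> K" unfolding K using k by linarith+
    have "(1 / 2 + \<kappa> / 2) * b\<^sup>2 \<le> K * b\<^sup>2" "1 / 2 * \<sigma>\<^sup>2 \<le> K * \<sigma>\<^sup>2" "1 / 2 * \<tau>\<^sup>2 \<le> K * \<tau>\<^sup>2"
      using K1 by (intro mult_right_mono; simp)+
    then show ?thesis by (simp add: algebra_simps)
  qed
  have 10: "K * \<theta>\<^sup>2 = B\<^sup>2 / (2 * \<kappa>) * \<theta>\<^sup>2 + B\<^sup>2 / 2 * \<theta>\<^sup>2 + \<kappa> / 2 * \<theta>\<^sup>2 + \<theta>\<^sup>2"
    unfolding K B_def by (simp add: algebra_simps)
  have X: "\<kappa> / 2 * a\<^sup>2 = (\<kappa> * a\<^sup>2) / 2" by simp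
  have 11: "0 \<le> \<kappa> / 2 * \<theta>\<^sup>2" using k by simp
  have 12: "A * (a + b) * s + Sl * (a + b) * s = B * a * s + B * b * s"
    by (simp add: B_def algebra_simps)
  have 13: "((\<theta> - \<theta>') / h - \<sigma> - \<tau>) * \<theta> = ((\<theta> - \<theta>') / h) * \<theta> - \<sigma> * \<theta> - \<tau> * \<theta>"
    by (simp add: algebra_simps)
  show ?thesis unfolding 13 10 b_def[symmetric] 
    using 1 2 3 4 5 6 7[unfolded X] 8[unfolded X] 9 11 12 by argo
qed

text \<open>Subtracting the two weak equations, tested with \<open>\<theta>\<close>, gives an integral identity; integrating the
  pointwise bound turns it into an energy inequality. Unprimed functions belong to the new time level, primed
  ones to the old; in the application \<open>w\<close> and \<open>w'\<close> are the projections of \<open>u\<close> and \<open>u'\<close>.\<close>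

lemma energy_step:
  fixes U U' u u' w w' ut :: "real ^ 'n \<Rightarrow> real" and V :: "real ^ 'n \<Rightarrow> real ^ 'n"
  assumes h: "h > 0" and d: "d > 0" and Sl: "Sl > 0"
    and V: "continuous_on UNIV V" "\<And>x. norm (V x) \<le> A"
    and U: "C1_per U gU" and U': "C1_per U' gU'"
    and u: "C1_per u gu" and u': "C1_per u' gu'"
    and w: "C1_per w gw" and w': "C1_per w' gw'"
    and ut: "continuous_on UNIV ut" "\<And>x. x \<in> cbox 0 1 \<Longrightarrow> \<bar>ut x - (u x - u' x) / h\<bar> \<le> D"
    and \<theta>: "\<theta> = (\<lambda>x. U x - w x)" and \<theta>': "\<theta>' = (\<lambda>x. U' x - w' x)"
    and \<rho>: "\<rho> = (\<lambda>x. u x - w x)" and \<sigma>: "\<sigma> = (\<lambda>x. (u x - u' x) / h - (w x - w' x) / h)"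
    and mean: "(LINT x|torus. \<theta> x) = 0"
    and eqU: "L2_inner (\<lambda>x. (U x - U' x) / h) \<theta> + form_a d Sl V U \<theta> + L2_inner (form_F Sl P U) \<theta> = b"
    and equ: "L2_inner ut \<theta> + form_a d Sl V u \<theta> + L2_inner (form_F Sl P u) \<theta> = b"
    and K: "K = (A + Sl)\<^sup>2 / (2 * (d * Sl)) + (A + Sl)\<^sup>2 / 2 + (d * Sl) / 2 + 1"
  shows "(LINT x|torus. (\<theta> x)\<^sup>2) - (LINT x|torus. (\<theta>' x)\<^sup>2)
    \<le> 2 * h * K * (LINT x|torus. (\<theta> x)\<^sup>2) + 2 * h * K * (H_inner \<rho> \<rho> + H_inner \<sigma> \<sigma> + D\<^sup>2)"
proof -
  note c = C1_per_continuous[OF U] C1_per_continuous[OF U'] C1_per_continuous[OF u]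
    C1_per_continuous[OF u'] C1_per_continuous[OF w] C1_per_continuous[OF w'] V(1) ut(1)
  define gt where "gt = (\<lambda>x. gU x - gw x)"
  define gr where "gr = (\<lambda>x. gu x - gw x)"
  define gs where "gs = (\<lambda>x. (1 / h) *\<^sub>R gr x + (- 1 / h) *\<^sub>R (gu' x - gw' x))"
  have C\<theta>: "C1_per \<theta> gt" unfolding \<theta> gt_def by (rule C1_per_diff[OF U w])
  have C\<theta>': "C1_per \<theta>' (\<lambda>x. gU' x - gw' x)" unfolding \<theta>' by (rule C1_per_diff[OF U' w'])
  have C\<rho>: "C1_per \<rho> gr" unfolding \<rho> gr_def by (rule C1_per_diff[OF u w])
  have "\<sigma> = (\<lambda>x. 1 / h * \<rho> x + (- 1 / h) * (u' x - w' x))"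
    unfolding \<sigma> \<rho> by (simp add: fun_eq_iff diff_divide_distrib)
  then have C\<sigma>: "C1_per \<sigma> gs"
    unfolding gs_def by (simp only: C1_per_lincomb[OF C\<rho> C1_per_diff[OF u' w']])
  note c' = c C1_per_continuous[OF C\<theta>] C1_per_continuous[OF C\<theta>'] C1_per_continuous[OF C\<rho>]
    C1_per_continuous[OF C\<sigma>]
  note int = integrable_torus_continuous
  define \<Phi> where "\<Phi> x = ((U x - U' x) / h - ut x) * \<theta> x + (V x \<bullet> (gU x - gu x)) * \<theta> x
      + (d * Sl) * ((gU x - gu x) \<bullet> gt x) + Sl * (norm (P + gU x) - norm (P + gu x)) * \<theta> x" for x
  define \<Psi> where "\<Psi> x = ((\<theta> x)\<^sup>2 - (\<theta>' x)\<^sup>2) / (2 * h) - K * (\<theta> x)\<^sup>2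
      - K * ((\<rho> x * \<rho> x + gr x \<bullet> gr x) + (\<sigma> x * \<sigma> x + gs x \<bullet> gs x) + D\<^sup>2)" for x
  have K0: "K \<ge> 0" unfolding K using d Sl by simp
  have "0 = (L2_inner (\<lambda>x. (U x - U' x) / h) \<theta> - L2_inner ut \<theta>) + (form_a d Sl V U \<theta> - form_a d Sl V u \<theta>)
      + (L2_inner (form_F Sl P U) \<theta> - L2_inner (form_F Sl P u) \<theta>)"
    using eqU equ by simp
  also have "L2_inner (\<lambda>x. (U x - U' x) / h) \<theta> - L2_inner ut \<theta>
      = (LINT x|torus. (U x - U' x) / h * \<theta> x - ut x * \<theta> x)"
    unfolding L2_inner_def using h
    by (intro Bochner_Integration.integral_diff[symmetric] int continuous_intros c') auto
  also have "form_a d Sl V U \<theta> - form_a d Sl V u \<theta>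
      = (LINT x|torus. ((V x \<bullet> gU x) * \<theta> x + d * Sl * (gU x \<bullet> gt x))
          - ((V x \<bullet> gu x) * \<theta> x + d * Sl * (gu x \<bullet> gt x)))"
    unfolding form_a_C1_per[OF U C\<theta> V(1)] form_a_C1_per[OF u C\<theta> V(1)]
    by (intro Bochner_Integration.integral_diff[symmetric] int continuous_intros c')
  also have "L2_inner (form_F Sl P U) \<theta> - L2_inner (form_F Sl P u) \<theta>
      = (LINT x|torus. Sl * norm (P + gU x) * \<theta> x - Sl * norm (P + gu x) * \<theta> x)"
    unfolding L2_inner_form_F_C1_per[OF U C1_per_continuous(1)[OF C\<theta>] mean]
      L2_inner_form_F_C1_per[OF u C1_per_continuous(1)[OF C\<theta>] mean]
    by (intro Bochner_Integration.integral_diff[symmetric] int continuous_intros c')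
  also have "(LINT x|torus. (U x - U' x) / h * \<theta> x - ut x * \<theta> x)
      + (LINT x|torus. ((V x \<bullet> gU x) * \<theta> x + d * Sl * (gU x \<bullet> gt x))
          - ((V x \<bullet> gu x) * \<theta> x + d * Sl * (gu x \<bullet> gt x)))
      + (LINT x|torus. Sl * norm (P + gU x) * \<theta> x - Sl * norm (P + gu x) * \<theta> x)
      = (LINT x|torus. ((U x - U' x) / h * \<theta> x - ut x * \<theta> x)
          + (((V x \<bullet> gU x) * \<theta> x + d * Sl * (gU x \<bullet> gt x)) - ((V x \<bullet> gu x) * \<theta> x + d * Sl * (gu x \<bullet> gt x)))
          + (Sl * norm (P + gU x) * \<theta> x - Sl * norm (P + gu x) * \<theta> x))"
    using h by (subst Bochner_Integration.integral_add; (subst Bochner_Integration.integral_add)?;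
        (intro int continuous_intros c')?; simp)
  also have "\<dots> = (LINT x|torus. \<Phi> x)"
    by (intro Bochner_Integration.integral_cong refl)
      (simp add: \<Phi>_def inner_diff_right inner_diff_left algebra_simps)
  finally have zero: "(LINT x|torus. \<Phi> x) = 0" by simp
  have "(LINT x|torus. \<Psi> x) \<le> (LINT x|torus. \<Phi> x)"
  proof (rule integral_mono)
    show "integrable torus \<Psi>" unfolding \<Psi>_def using h by (intro int continuous_intros c') auto
    show "integrable torus \<Phi>" unfolding \<Phi>_def using h by (intro int continuous_intros c') auto
    fix x :: "real^'n" assume "x \<in> space torus"
    then have x: "x \<in> cbox 0 1" by simp
    define \<tau> where "\<tau> = ut x - (u x - u' x) / h"
    have \<tau>: "\<tau>\<^sup>2 \<le> D\<^sup>2" using power_mono[OF ut(2)[OF x], of 2] by (simp add: \<tau>_def)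
    have n: "\<bar>norm (P + gU x) - norm (P + gu x)\<bar> \<le> norm (gt x - gr x)"
      using norm_triangle_ineq3[of "P + gU x" "P + gu x"] by (simp add: gt_def gr_def)
    have "0 < d * Sl" using d Sl by simp
    from pointwise_energy_bound[OF h this less_imp_le[OF Sl] V(2) n K, of "\<theta> x" "\<theta>' x" "\<sigma> x" \<tau>]
    have "((\<theta> x)\<^sup>2 - (\<theta>' x)\<^sup>2) / (2 * h) - K * (\<theta> x)\<^sup>2 - K * ((norm (gr x))\<^sup>2 + (\<sigma> x)\<^sup>2 + \<tau>\<^sup>2)
      \<le> ((\<theta> x - \<theta>' x) / h - \<sigma> x - \<tau>) * \<theta> x + (V x \<bullet> (gt x - gr x)) * \<theta> x
        + d * Sl * ((gt x - gr x) \<bullet> gt x) + Sl * (norm (P + gU x) - norm (P + gu x)) * \<theta> x" .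
    also have "(\<theta> x - \<theta>' x) / h - \<sigma> x - \<tau> = (U x - U' x) / h - ut x"
      by (simp add: \<theta> \<theta>' \<sigma> \<tau>_def diff_divide_distrib)
    also have "gt x - gr x = gU x - gu x" by (simp add: gt_def gr_def)
    finally have main: "((\<theta> x)\<^sup>2 - (\<theta>' x)\<^sup>2) / (2 * h) - K * (\<theta> x)\<^sup>2 - K * ((norm (gr x))\<^sup>2 + (\<sigma> x)\<^sup>2 + \<tau>\<^sup>2) \<le> \<Phi> x"
      by (simp add: \<Phi>_def)
    have "(norm (gr x))\<^sup>2 + (\<sigma> x)\<^sup>2 + \<tau>\<^sup>2
        \<le> (\<rho> x * \<rho> x + gr x \<bullet> gr x) + (\<sigma> x * \<sigma> x + gs x \<bullet> gs x) + D\<^sup>2"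
      using \<tau> power2_norm_eq_inner[of "gr x"] power2_eq_square[of "\<sigma> x"]
        zero_le_square[of "\<rho> x"] inner_ge_zero[of "gs x"] by linarith
    from mult_left_mono[OF this K0] main show "\<Psi> x \<le> \<Phi> x" unfolding \<Psi>_def by linarith
  qed
  moreover have "(LINT x|torus. \<Psi> x) = ((LINT x|torus. (\<theta> x)\<^sup>2) - (LINT x|torus. (\<theta>' x)\<^sup>2)) / (2 * h)
      - K * (LINT x|torus. (\<theta> x)\<^sup>2) - K * (H_inner \<rho> \<rho> + H_inner \<sigma> \<sigma> + D\<^sup>2)"
  proof -
    have i1: "integrable torus (\<lambda>x. (\<theta> x)\<^sup>2)" "integrable torus (\<lambda>x. (\<theta>' x)\<^sup>2)"
      by (intro int continuous_intros c')+
    have i2: "integrable torus (\<lambda>x. \<rho> x * \<rho> x + gr x \<bullet> gr x)" "integrable torus (\<lambda>x. \<sigma> x * \<sigma> x + gs x \<bullet> gs x)"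
      "integrable (torus :: (real^'n) measure) (\<lambda>x. D\<^sup>2)"
      by (intro int continuous_intros c')+
    have "(LINT x|torus. \<Psi> x) = (LINT x|torus. ((\<theta> x)\<^sup>2 - (\<theta>' x)\<^sup>2) / (2 * h))
        - (LINT x|torus. K * (\<theta> x)\<^sup>2)
        - (LINT x|torus. K * ((\<rho> x * \<rho> x + gr x \<bullet> gr x) + (\<sigma> x * \<sigma> x + gs x \<bullet> gs x) + D\<^sup>2))"
      unfolding \<Psi>_def
      by (subst Bochner_Integration.integral_diff;
          (intro Bochner_Integration.integrable_diff Bochner_Integration.integrable_add integrable_divide integrable_mult_right i1 i2)?)
        (subst Bochner_Integration.integral_diff; (intro Bochner_Integration.integrable_diff integrable_divide integrable_mult_right i1)?; simp)
    then show ?thesis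
      using i1 i2 by (simp add: C1_per_H_inner[OF C\<rho> C\<rho>] C1_per_H_inner[OF C\<sigma> C\<sigma>] measure_torus)
  qed
  ultimately have "((LINT x|torus. (\<theta> x)\<^sup>2) - (LINT x|torus. (\<theta>' x)\<^sup>2)) / (2 * h)
      \<le> K * (LINT x|torus. (\<theta> x)\<^sup>2) + K * (H_inner \<rho> \<rho> + H_inner \<sigma> \<sigma> + D\<^sup>2)"
    using zero by linarith
  then show ?thesis using h by (simp add: pos_divide_le_eq algebra_simps)
qed

section \<open>Discrete Gronwall inequality\<close>

lemma discrete_gronwall:
  fixes e g :: "nat \<Rightarrow> real"
  assumes e0: "e 0 = 0" and x: "0 \<le> x" "x \<le> 1 / 2" and g: "\<And>k. k \<in> {1..m} \<Longrightarrow> 0 \<le> g k"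
    and step: "\<And>k. k \<in> {1..m} \<Longrightarrow> e k - e (k - 1) \<le> x * e k + x * g k"
    and n: "n \<le> m"
  shows "e n \<le> exp (2 * x * real n) * (x * (\<Sum>j=1..n. g j))"
  using n
proof (induction n)
  case 0
  then show ?case by (simp add: e0)
next
  case (Suc n)
  let ?s = "\<lambda>n. x * (\<Sum>j=1..n. g j)"
  have s: "0 \<le> ?s n" using Suc.prems g x by (intro mult_nonneg_nonneg sum_nonneg) auto
  have gn: "0 \<le> g (Suc n)" using g Suc.prems by auto
  have IH: "e n \<le> exp (2 * x * real n) * ?s n" using Suc by simp
  have "(1 - x) * e (Suc n) \<le> e n + x * g (Suc n)"
    using step[of "Suc n"] Suc.prems by (simp add: algebra_simps)
  also have "\<dots> \<le> exp (2 * x * real n) * ?s n + exp (2 * x * real n) * (x * g (Suc n))"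
  proof (intro add_mono IH)
    have "1 * (x * g (Suc n)) \<le> exp (2 * x * real n) * (x * g (Suc n))"
      using x gn by (intro mult_right_mono) auto
    then show "x * g (Suc n) \<le> exp (2 * x * real n) * (x * g (Suc n))" by simp
  qed
  also have "\<dots> = exp (2 * x * real n) * ?s (Suc n)" by (simp add: algebra_simps)
  finally have A: "(1 - x) * e (Suc n) \<le> exp (2 * x * real n) * ?s (Suc n)" .
  \<comment> \<open>This is where \<open>x \<le> 1 / 2\<close> is needed.\<close>
  have B: "1 \<le> exp (2 * x) * (1 - x)"
  proof -
    have "1 \<le> (1 + 2 * x) * (1 - x)" using mult_left_mono[OF x(2) x(1)] by (simp add: algebra_simps)
    also have "\<dots> \<le> exp (2 * x) * (1 - x)" using x exp_ge_add_one_self[of "2 * x"] by (intro mult_right_mono) auto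
    finally show ?thesis .
  qed
  have s': "0 \<le> exp (2 * x * real n) * ?s (Suc n)" using s gn x by (simp add: distrib_left)
  have "e (Suc n) = 1 / (1 - x) * ((1 - x) * e (Suc n))" using x by simp
  also have "\<dots> \<le> exp (2 * x) * (exp (2 * x * real n) * ?s (Suc n))"
  proof -
    have "1 / (1 - x) * ((1 - x) * e (Suc n)) \<le> 1 / (1 - x) * (exp (2 * x * real n) * ?s (Suc n))"
      using A x by (intro mult_left_mono) auto
    also have "\<dots> \<le> exp (2 * x) * (exp (2 * x * real n) * ?s (Suc n))"
      using B x by (intro mult_right_mono s') (simp add: pos_divide_le_eq)
    finally show ?thesis .
  qed
  also have "\<dots> = exp (2 * x * real (Suc n)) * ?s (Suc n)"
    by (simp add: algebra_simps exp_add)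
  finally show ?case .
qed

section \<open>The POD of the snapshots\<close>

lemma pod_space_C1_per:
  assumes "\<And>i. i < N \<Longrightarrow> C1_per (y i) (gy i)" "\<And>i. i < N \<Longrightarrow> (LINT x|torus. y i x) = 0"
    and \<psi>: "\<psi> \<in> pod_space N y \<mu> v r"
  shows "\<exists>g. C1_per \<psi> g" "(LINT x|torus. \<psi> x) = 0"
proof -
  have mode: "pod_mode N y (v k)
      = (\<lambda>x. \<Sum>j<N. (vec_index (v k) j / H_norm (\<lambda>x. \<Sum>j<N. vec_index (v k) j * y j x)) * y j x)" for k
    by (simp add: pod_mode_def sum_divide_distrib)
  obtain c where c: "\<psi> = (\<lambda>x. \<Sum>k\<in>{k\<in>{1..r}. \<mu> k > 0}. c k * pod_mode N y (v k) x)"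
    using \<psi> unfolding pod_space_def by blast
  define b where "b j = (\<Sum>k\<in>{k\<in>{1..r}. \<mu> k > 0}. c k *
      (vec_index (v k) j / H_norm (\<lambda>x. \<Sum>j<N. vec_index (v k) j * y j x)))" for j
  have \<psi>b: "\<psi> = (\<lambda>x. \<Sum>j<N. b j * y j x)"
    unfolding c mode b_def sum_distrib_left sum_distrib_right
    by (subst sum.swap) (simp only: mult.assoc)
  have "C1_per \<psi> (\<lambda>x. \<Sum>j<N. b j *\<^sub>R gy j x)"
    unfolding \<psi>b using assms by (intro C1_per_sum) auto
  then show "\<exists>g. C1_per \<psi> g" by blast
  have "(LINT x|torus. \<psi> x) = (\<Sum>j<N. LINT x|torus. b j * y j x)"
    unfolding \<psi>b
    by (intro Bochner_Integration.integral_sum integrable_mult_right integrable_torus_continuous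
        C1_per_continuous(1)[OF assms(1)]) auto
  then show "(LINT x|torus. \<psi> x) = 0" using assms(2) by simp
qed

lemma pod_space_diff:
  assumes "\<psi> \<in> pod_space N y \<mu> v r" "\<phi> \<in> pod_space N y \<mu> v r"
  shows "(\<lambda>x. \<psi> x - \<phi> x) \<in> pod_space N y \<mu> v r"
proof -
  let ?R = "{k\<in>{1..r}. \<mu> k > 0}"
  obtain c b where "\<psi> = (\<lambda>x. \<Sum>k\<in>?R. c k * pod_mode N y (v k) x)"
    "\<phi> = (\<lambda>x. \<Sum>k\<in>?R. b k * pod_mode N y (v k) x)"
    using assms unfolding pod_space_def by blast
  then have "(\<lambda>x. \<psi> x - \<phi> x) = (\<lambda>x. \<Sum>k\<in>?R. (c k - b k) * pod_mode N y (v k) x)"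
    by (simp add: sum_subtractf left_diff_distrib)
  then show ?thesis unfolding pod_space_def by (intro CollectI exI)
qed

lemma snapshot_value: "k \<le> m \<Longrightarrow> snapshot T m u k = u (grid T m k)"
  by (simp add: snapshot_def)

lemma snapshot_quotient:
  "k \<in> {1..m} \<Longrightarrow> snapshot T m u (m + k) =
     (\<lambda>x. 1 / (T / real m) * u (grid T m k) x + (- 1 / (T / real m)) * u (grid T m (k - 1)) x)"
  by (auto simp: snapshot_def fun_eq_iff diff_divide_distrib algebra_simps)

lemma snapshot_cases:
  fixes i m :: nat
  assumes "i < 2 * m + 1"
  obtains "i \<le> m" | k where "k \<in> {1..m}" "i = m + k"
proof (cases "i \<le> m")
  case False
  then have "i - m \<in> {1..m}" "i = m + (i - m)" using assms by auto
  then show ?thesis using that by blast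
qed (use that in blast)

text \<open>The \<open>2 * m + 1\<close> snapshots lie in the span of the \<open>m\<close> values at positive grid times.\<close>

lemma snapshot_span:
  assumes u0: "u 0 = (\<lambda>x. 0)" and i: "i < 2 * m + 1"
  shows "\<exists>B. \<forall>x. snapshot T m u i x = (\<Sum>j\<in>{1..m}. B j * u (grid T m j) x)"
proof -
  \<comment> \<open>The value at the initial time vanishes, so it is the empty combination.\<close>
  have val: "\<exists>B. \<forall>x. u (grid T m k) x = (\<Sum>j\<in>{1..m}. B j * u (grid T m j) x)" if "k \<le> m" for k
  proof (cases "k = 0")
    case True
    then show ?thesis using u0 by (intro exI[of _ "\<lambda>_. 0"]) (simp add: grid_def)
  next
    case False
    have "(\<Sum>j\<in>{1..m}. (if j = k then 1 else 0) * u (grid T m j) x)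
        = (\<Sum>j\<in>{1..m}. if j = k then u (grid T m j) x else 0)" for x
      by (intro sum.cong) auto
    then show ?thesis using False that by (intro exI[of _ "\<lambda>j. if j = k then 1 else 0"]) simp
  qed
  from i show ?thesis
  proof (cases rule: snapshot_cases)
    case 1
    then show ?thesis using val by (simp add: snapshot_value)
  next
    case (2 k)
    then have "k \<le> m" "k - 1 \<le> m" by auto
    obtain B where B1: "\<And>x. u (grid T m k) x = (\<Sum>j\<in>{1..m}. B j * u (grid T m j) x)"
      using val[OF \<open>k \<le> m\<close>] by blast
    obtain B' where B2: "\<And>x. u (grid T m (k - 1)) x = (\<Sum>j\<in>{1..m}. B' j * u (grid T m j) x)"
      using val[OF \<open>k - 1 \<le> m\<close>] by blast
    let ?a = "1 / (T / real m)"
    have "snapshot T m u i x = (\<Sum>j\<in>{1..m}. (?a * B j + (- ?a) * B' j) * u (grid T m j) x)" for x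
    proof -
      have "snapshot T m u i x = ?a * u (grid T m k) x + (- ?a) * u (grid T m (k - 1)) x"
        using 2 by (simp add: snapshot_quotient)
      also have "\<dots> = ?a * (\<Sum>j\<in>{1..m}. B j * u (grid T m j) x) + (- ?a) * (\<Sum>j\<in>{1..m}. B' j * u (grid T m j) x)"
        by (simp only: B1[symmetric] B2[symmetric])
      also have "\<dots> = (\<Sum>j\<in>{1..m}. (?a * B j + (- ?a) * B' j) * u (grid T m j) x)"
        unfolding sum_distrib_left sum.distrib[symmetric]
        by (intro sum.cong refl) (simp only: distrib_right mult.assoc)
      finally show ?thesis .
    qed
    then show ?thesis by (intro exI[of _ "\<lambda>j. ?a * B j + (- ?a) * B' j"] allI)
  qed
qed

section \<open>The error estimate\<close>

lemma L2_norm_power2: "(L2_norm f)\<^sup>2 = (LINT x|torus. f x * f x)"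
  unfolding L2_norm_def L2_inner_def by (intro real_sqrt_pow2 integral_nonneg_AE) simp

lemma L2_norm_diff_le:
  assumes \<theta>: "C1_per \<theta> gt" and \<rho>: "C1_per \<rho> gr"
  shows "(L2_norm (\<lambda>x. \<theta> x - \<rho> x))\<^sup>2 \<le> 2 * (LINT x|torus. (\<theta> x)\<^sup>2) + 2 * H_inner \<rho> \<rho>"
proof -
  note c = C1_per_continuous[OF \<theta>] C1_per_continuous[OF \<rho>]
  have i: "integrable torus (\<lambda>x. (\<theta> x)\<^sup>2)" "integrable torus (\<lambda>x. \<rho> x * \<rho> x + gr x \<bullet> gr x)"
    by (intro integrable_torus_continuous continuous_intros c)+
  have "(L2_norm (\<lambda>x. \<theta> x - \<rho> x))\<^sup>2 = (LINT x|torus. (\<theta> x - \<rho> x) * (\<theta> x - \<rho> x))"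
    by (rule L2_norm_power2)
  also have "\<dots> \<le> (LINT x|torus. 2 * (\<theta> x)\<^sup>2 + 2 * (\<rho> x * \<rho> x + gr x \<bullet> gr x))"
  proof (rule integral_mono)
    show "integrable torus (\<lambda>x. (\<theta> x - \<rho> x) * (\<theta> x - \<rho> x))"
      by (intro integrable_torus_continuous continuous_intros c)
    show "integrable torus (\<lambda>x. 2 * (\<theta> x)\<^sup>2 + 2 * (\<rho> x * \<rho> x + gr x \<bullet> gr x))"
      by (intro integrable_torus_continuous continuous_intros c)
    fix x
    have "(\<theta> x - \<rho> x) * (\<theta> x - \<rho> x) \<le> 2 * (\<theta> x)\<^sup>2 + 2 * (\<rho> x * \<rho> x)"
      using zero_le_power2[of "\<theta> x + \<rho> x"] by (simp add: power2_eq_square algebra_simps)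
    then show "(\<theta> x - \<rho> x) * (\<theta> x - \<rho> x) \<le> 2 * (\<theta> x)\<^sup>2 + 2 * (\<rho> x * \<rho> x + gr x \<bullet> gr x)"
      by (rule order_trans) simp
  qed
  also have "\<dots> = 2 * (LINT x|torus. (\<theta> x)\<^sup>2) + 2 * H_inner \<rho> \<rho>"
    unfolding C1_per_H_inner[OF \<rho> \<rho>]
    by (subst Bochner_Integration.integral_add; (intro integrable_mult_right i)?; simp del: distrib_left_numeral)
  finally show ?thesis .
qed

theorem theorem4p4:
  fixes d Sl A T :: real
    and P :: "real ^ 'n"
    and V :: "real \<Rightarrow> real ^ 'n \<Rightarrow> real ^ 'n"
    and u :: "real \<Rightarrow> real ^ 'n \<Rightarrow> real"
  assumes "d > 0" and "Sl > 0" and "T > 0"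
    and "norm P = 1"
    and "admissible_velocity P A T V"
    and "weak_solution d Sl P V T u"
    and "smooth_on (UNIV \<times> {0..T}) (\<lambda>(x, t). u t x)"
  shows "\<exists>C>0. \<exists>\<delta>>0. \<forall>m r. \<forall>\<mu> v U.
           m \<ge> 1 \<and> T / real m < \<delta> \<and> 1 \<le> r \<and> r \<le> 2 * m + 1 \<and>
           sorted_eigensystem (2 * m + 1) (corr_matrix (2 * m + 1) (snapshot T m u)) \<mu> v \<and>
           backward_euler_galerkin d Sl P V T m
             (pod_space (2 * m + 1) (snapshot T m u) \<mu> v r) U
           \<longrightarrow> 1 / real m * (\<Sum>k=1..m. (L2_norm (\<lambda>x. U k x - u (grid T m k) x))\<^sup>2)
               \<le> C * ((T / real m)\<^sup>2 + (\<Sum>l=r+1..m. \<mu> l))"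
proof -
  note d = \<open>d > 0\<close> and Sl = \<open>Sl > 0\<close> and T = \<open>T > 0\<close>
  obtain G ut M where
    G: "\<And>t. t \<in> {0..T} \<Longrightarrow> continuous_on UNIV (G t)"
      "\<And>t x. t \<in> {0..T} \<Longrightarrow> (u t has_derivative (\<lambda>h. G t x \<bullet> h)) (at x)"
    and ut: "\<And>t. t \<in> {0..T} \<Longrightarrow> continuous_on UNIV (ut t)"
      "\<And>t x. t \<in> {0..T} \<Longrightarrow> vector_derivative (\<lambda>s. u s x) (at t within {0..T}) = ut t x"
    and M: "\<And>x s t. x \<in> cbox 0 1 \<Longrightarrow> 0 \<le> s \<Longrightarrow> s < t \<Longrightarrow> t \<le> T \<Longrightarrow>
       \<bar>ut t x - (u t x - u s x) / (t - s)\<bar> \<le> M * (t - s)"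
    by (rule smooth_in_time[OF T assms(7)], rule that, assumption+)
  have uH: "u t \<in> H_space" if "t \<in> {0..T}" for t
    using \<open>weak_solution d Sl P V T u\<close> that unfolding weak_solution_def by blast
  have u0: "u 0 = (\<lambda>x. 0)"
    using \<open>weak_solution d Sl P V T u\<close> unfolding weak_solution_def by blast
  have C1u: "C1_per (u t) (G t)" and meanu: "(LINT x|torus. u t x) = 0" if "t \<in> {0..T}" for t
    using uH[OF that] G[OF that] by (auto simp: C1_per_def H_space_def H1_per_def)
  have Vc: "continuous_on UNIV (V t)" and VA: "norm (V t x) \<le> A" if "t \<in> {0..T}" for t x
  proof -
    have "Ck_on 1 UNIV (\<lambda>x. V t x $ i)" for i
      using \<open>admissible_velocity P A T V\<close> that unfolding admissible_velocity_def by blast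
    then have "continuous_on UNIV (\<lambda>x. \<chi> i. V t x $ i)"
      by (intro continuous_on_vec_lambda Ck_on_continuous)
    then show "continuous_on UNIV (V t)" by simp
    show "norm (V t x) \<le> A"
      using \<open>admissible_velocity P A T V\<close> that unfolding admissible_velocity_def by blast
  qed
  define K where "K = (A + Sl)\<^sup>2 / (2 * (d * Sl)) + (A + Sl)\<^sup>2 / 2 + (d * Sl) / 2 + 1"
  have K: "K \<ge> 1" unfolding K_def using d Sl by simp
  define C where "C = 4 * K * T * exp (4 * K * T) * (M\<^sup>2 + 3) + 6"
  define \<delta> where "\<delta> = 1 / (4 * K)"
  have C: "C > 0" unfolding C_def using K T by (intro add_nonneg_pos mult_nonneg_nonneg) auto
  have \<delta>: "\<delta> > 0" unfolding \<delta>_def using K by simp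
  have "1 / real m * (\<Sum>k=1..m. (L2_norm (\<lambda>x. U k x - u (grid T m k) x))\<^sup>2)
      \<le> C * ((T / real m)\<^sup>2 + (\<Sum>l=r+1..m. \<mu> l))"
    if m: "m \<ge> 1" and small: "T / real m < \<delta>" and r: "r \<le> 2 * m + 1"
      and eig: "sorted_eigensystem (2 * m + 1) (corr_matrix (2 * m + 1) (snapshot T m u)) \<mu> v"
      and galerkin: "backward_euler_galerkin d Sl P V T m (pod_space (2 * m + 1) (snapshot T m u) \<mu> v r) U"
    for m r \<mu> v U
  proof -
    define N where "N = 2 * m + 1"
    define y where "y = snapshot T m u"
    define h where "h = T / real m"
    define S where "S = pod_space N y \<mu> v r"
    define t where "t = grid T m"
    define gy where "gy i = (if i \<le> m then G (t i)
        else (\<lambda>x. (1 / h) *\<^sub>R G (t (i - m)) x + (- 1 / h) *\<^sub>R G (t (i - m - 1)) x))" for i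
    have h: "h > 0" "h * real m = T" using m T by (auto simp: h_def)
    have tk: "t k \<in> {0..T}" if "k \<le> m" for k
    proof -
      have "real k * h \<le> real m * h" using that h by (intro mult_right_mono) auto
      then show ?thesis using h by (simp add: t_def grid_def h_def[symmetric] mult.commute)
    qed
    have th: "t k - t (k - 1) = h" if "k \<in> {1..m}" for k
      using that by (simp add: t_def grid_def h_def[symmetric] of_nat_diff algebra_simps)
    have yk: "y k = u (t k)" if "k \<le> m" for k
      using that by (simp add: y_def t_def snapshot_value)
    have yq: "y (m + k) = (\<lambda>x. 1 / h * u (t k) x + (- 1 / h) * u (t (k - 1)) x)" if "k \<in> {1..m}" for k
      unfolding y_def t_def h_def by (rule snapshot_quotient[OF that])
    have C1y: "C1_per (y i) (gy i)" and meany: "(LINT x|torus. y i x) = 0" if i: "i < N" for i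
    proof -
      have "C1_per (y i) (gy i) \<and> (LINT x|torus. y i x) = 0"
        using i unfolding N_def
      proof (cases rule: snapshot_cases)
        case 1
        then show ?thesis using C1u meanu tk by (simp add: yk gy_def)
      next
        case (2 k)
        then have k: "t k \<in> {0..T}" "t (k - 1) \<in> {0..T}" using tk by auto
        have "C1_per (y i) (gy i)"
          using C1_per_lincomb[OF C1u[OF k(1)] C1u[OF k(2)], of "1 / h" "- 1 / h"] 2 yq[OF 2(1)]
          by (simp add: gy_def)
        moreover have "(LINT x|torus. 1 / h * u (t k) x + (- 1 / h) * u (t (k - 1)) x)
            = 1 / h * (LINT x|torus. u (t k) x) + (- 1 / h) * (LINT x|torus. u (t (k - 1)) x)"
          using h(1) C1_per_continuous(1)[OF C1u[OF k(1)]] C1_per_continuous(1)[OF C1u[OF k(2)]]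
          by (subst Bochner_Integration.integral_add)
            (auto intro!: integrable_torus_continuous continuous_intros)
        ultimately show ?thesis using 2 yq[OF 2(1)] meanu k by simp
      qed
      then show "C1_per (y i) (gy i)" "(LINT x|torus. y i x) = 0" by auto
    qed
    interpret pod_system N y gy \<mu> v
      using C1y eig by unfold_locales (auto simp: N_def y_def)
    define w where "w = pod_proj r"
    have rN: "r \<le> N" using r by (simp add: N_def)
    have wS: "w k \<in> S" for k unfolding w_def S_def by (rule pod_proj_mem[OF rN])
    have w0: "w 0 = (\<lambda>x. 0)"
      using pod_proj_lincomb[OF rN, of 0 0 0 0 0] yk[of 0] u0
      by (auto simp: w_def N_def t_def grid_def fun_eq_iff)
    have wq: "w (m + k) x = 1 / h * w k x + (- 1 / h) * w (k - 1) x" if "k \<in> {1..m}" for k x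
      unfolding w_def
      by (rule pod_proj_lincomb[OF rN]) (use that yq[OF that] yk in \<open>auto simp: N_def\<close>)
    have SC1: "\<exists>g. C1_per \<psi> g" and Smean: "(LINT x|torus. \<psi> x) = 0" if "\<psi> \<in> S" for \<psi>
      using pod_space_C1_per[OF C1y meany that[unfolded S_def]] by simp_all
    have US: "U k \<in> S" if "k \<le> m" for k
      using galerkin that unfolding backward_euler_galerkin_def S_def N_def y_def by auto
    have U0: "U 0 = (\<lambda>x. 0)"
      using galerkin unfolding backward_euler_galerkin_def by blast
    \<comment> \<open>The error \<open>U k - u (t k)\<close> is \<open>\<theta> k - (y k - w k)\<close>, where \<open>\<theta> k\<close> lies in the POD space.\<close>
    define \<theta> where "\<theta> k = (\<lambda>x. U k x - w k x)" for k
    define e where "e k = (LINT x|torus. (\<theta> k x)\<^sup>2)" for k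
    define R where "R i = H_inner (\<lambda>x. y i x - w i x) (\<lambda>x. y i x - w i x)" for i
    have \<theta>S: "\<theta> k \<in> S" if "k \<le> m" for k
      unfolding \<theta>_def S_def using US[OF that] wS[of k] by (intro pod_space_diff) (auto simp: S_def)
    have C1err: "\<exists>g. C1_per (\<lambda>x. y i x - w i x) g" if "i < N" for i
      using SC1[OF wS[of i]] C1_per_diff[OF C1y[OF that]] by blast
    have R0: "0 \<le> R i" if "i < N" for i
      using C1err[OF that] H_inner_self_nonneg unfolding R_def by blast

    define \<Lambda> where "\<Lambda> = (\<Sum>l=r+1..m. \<mu> l)"
    have \<Lambda>0: "0 \<le> \<Lambda>" unfolding \<Lambda>_def by (intro sum_nonneg eigenvalue_nonneg) (auto simp: N_def)
    have "\<exists>B. \<forall>i<N. \<forall>x. y i x = (\<Sum>j\<in>{1..m}. B i j * u (t j) x)"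
      using snapshot_span[of u _ m T, OF u0] unfolding N_def y_def t_def by metis
    then obtain B where B: "\<And>i x. i < N \<Longrightarrow> y i x = (\<Sum>j\<in>{1..m}. B i j * u (t j) x)" by blast
    \<comment> \<open>Hence the sum up to \<open>m\<close> already contains all nonzero discarded eigenvalues.\<close>
    have \<mu>0: "\<mu> l = 0" if "m < l" "l \<le> N" for l
      by (rule eigenvalue_zero_beyond_rank[OF B]) (use that in auto)
    have "(\<Sum>i<N. R i) = real N * (\<Sum>l\<in>{r+1..N}. \<mu> l)"
      unfolding R_def w_def by (rule pod_proj_error[OF rN])
    also have "(\<Sum>l\<in>{r+1..N}. \<mu> l) = \<Lambda>"
      unfolding \<Lambda>_def using \<mu>0 by (intro sum.mono_neutral_right) (auto simp: N_def)
    finally have sumR: "(\<Sum>i<N. R i) = real N * \<Lambda>" .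
    have sumRm: "(\<Sum>k=1..m. R k + R (m + k)) \<le> real N * \<Lambda>"
    proof -
      have "(\<Sum>k=1..m. R (m + k)) = (\<Sum>i\<in>(+) m ` {1..m}. R i)"
        by (subst sum.reindex) auto
      then have "(\<Sum>k=1..m. R k + R (m + k)) = (\<Sum>i\<in>{1..m} \<union> (+) m ` {1..m}. R i)"
        by (subst sum.union_disjoint) (auto simp: sum.distrib)
      also have "\<dots> \<le> (\<Sum>i<N. R i)"
        by (intro sum_mono2) (auto simp: N_def intro!: R0)
      finally show ?thesis using sumR by simp
    qed
    \<comment> \<open>The bound \<open>\<delta>\<close> on the time step makes this factor of the Gronwall inequality at most 1/2.\<close>
    define x where "x = 2 * h * K"
    have x: "0 \<le> x" "x \<le> 1 / 2" "x * real m = 2 * K * T"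
    proof -
      show "0 \<le> x" using h K by (simp add: x_def)
      have "h * (4 * K) \<le> 1"
        using small K by (simp add: \<delta>_def h_def[symmetric] pos_less_divide_eq)
      then show "x \<le> 1 / 2" by (simp add: x_def)
      show "x * real m = 2 * K * T" unfolding x_def h(2)[symmetric] by simp
    qed
    define g where "g k = R k + R (m + k) + (M * h)\<^sup>2" for k
    have g0: "0 \<le> g k" if "k \<in> {1..m}" for k
      using that R0[of k] R0[of "m + k"] by (auto simp: g_def N_def)
    have step: "e k - e (k - 1) \<le> x * e k + x * g k" if k: "k \<in> {1..m}" for k
    proof -
      have km: "k \<le> m" "k - 1 \<le> m" using k by auto
      obtain gU gU' gw gw' where C1s: "C1_per (U k) gU" "C1_per (U (k - 1)) gU'"
        "C1_per (w k) gw" "C1_per (w (k - 1)) gw'"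
        using SC1 US[OF km(1)] US[OF km(2)] wS by metis
      obtain gt where gt: "C1_per (\<theta> k) gt" using SC1[OF \<theta>S[OF km(1)]] by blast
      have mean: "(LINT x|torus. \<theta> k x) = 0" by (rule Smean[OF \<theta>S[OF km(1)]])
      have \<theta>H: "\<theta> k \<in> H_space" by (rule C1_per_H_space[OF gt mean])
      have D: "\<bar>ut (t k) z - (u (t k) z - u (t (k - 1)) z) / h\<bar> \<le> M * h" if "z \<in> cbox 0 1" for z
        using M[OF that, of "t (k - 1)" "t k"] tk[OF km(1)] tk[OF km(2)] th[OF k] h by auto
      have \<rho>: "(\<lambda>z. y k z - w k z) = (\<lambda>z. u (t k) z - w k z)" using yk[OF km(1)] by simp
      have \<sigma>: "(\<lambda>z. y (m + k) z - w (m + k) z)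
          = (\<lambda>z. (u (t k) z - u (t (k - 1)) z) / h - (w k z - w (k - 1) z) / h)"
        using yq[OF k] wq[OF k] by (auto simp: fun_eq_iff diff_divide_distrib)
      have eqU: "L2_inner (\<lambda>z. (U k z - U (k - 1) z) / h) (\<theta> k) + form_a d Sl (V (t k)) (U k) (\<theta> k)
          + L2_inner (form_F Sl P (U k)) (\<theta> k) = L2_inner (\<lambda>z. - (P \<bullet> V (t k) z)) (\<theta> k)"
        using galerkin k \<theta>S[OF km(1)]
        unfolding backward_euler_galerkin_def S_def N_def y_def h_def t_def by blast
      have "L2_inner (\<lambda>z. vector_derivative (\<lambda>s. u s z) (at (t k) within {0..T})) (\<theta> k)
          + form_a d Sl (V (t k)) (u (t k)) (\<theta> k) + L2_inner (form_F Sl P (u (t k))) (\<theta> k)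
          = L2_inner (\<lambda>z. - (P \<bullet> V (t k) z)) (\<theta> k)"
        using \<open>weak_solution d Sl P V T u\<close> tk[OF km(1)] \<theta>H unfolding weak_solution_def by blast
      then have equ: "L2_inner (ut (t k)) (\<theta> k)
          + form_a d Sl (V (t k)) (u (t k)) (\<theta> k) + L2_inner (form_F Sl P (u (t k))) (\<theta> k)
          = L2_inner (\<lambda>z. - (P \<bullet> V (t k) z)) (\<theta> k)"
        by (simp add: ut(2)[OF tk[OF km(1)]])
      have "e k - e (k - 1) \<le> 2 * h * K * e k + 2 * h * K * (R k + R (m + k) + (M * h)\<^sup>2)"
        unfolding e_def R_def
        by (rule energy_step[OF h(1) d Sl Vc[OF tk[OF km(1)]] VA[OF tk[OF km(1)]] C1s(1,2)
              C1u[OF tk[OF km(1)]] C1u[OF tk[OF km(2)]] C1s(3,4) ut(1)[OF tk[OF km(1)]] D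
              \<theta>_def \<theta>_def \<rho> \<sigma> mean eqU equ K_def])
      then show ?thesis by (simp add: x_def g_def)
    qed
    have e0: "e 0 = 0" by (simp add: e_def \<theta>_def U0 w0)
    define E where "E = exp (4 * K * T) * (x * (\<Sum>j=1..m. g j))"
    have eE: "e k \<le> E" if "k \<in> {1..m}" for k
    proof -
      have km: "k \<le> m" using that by simp
      have "e k \<le> exp (2 * x * real k) * (x * (\<Sum>j=1..k. g j))"
        by (rule discrete_gronwall[OF e0 x(1,2) g0 step km])
      also have "\<dots> \<le> E" unfolding E_def
      proof (intro mult_mono)
        have "2 * x * real k \<le> 2 * x * real m" using x km by (intro mult_left_mono) auto
        then show "exp (2 * x * real k) \<le> exp (4 * K * T)" using x(3) by simp
        show "(\<Sum>j=1..k. g j) \<le> (\<Sum>j=1..m. g j)" using km g0 by (intro sum_mono2) auto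
        show "0 \<le> x * (\<Sum>j=1..k. g j)" using km x g0 by (intro mult_nonneg_nonneg sum_nonneg) auto
      qed (use x g0 km in \<open>auto intro!: sum_nonneg\<close>)
      finally show ?thesis .
    qed
    have hN: "h * real N \<le> 3 * T"
    proof -
      have "h * real N \<le> h * (3 * real m)" using m h by (intro mult_left_mono) (auto simp: N_def)
      also have "\<dots> = 3 * (h * real m)" by simp
      finally show ?thesis unfolding h(2) .
    qed
    have EC: "E \<le> exp (4 * K * T) * (2 * K * (3 * T * \<Lambda> + T * M\<^sup>2 * h\<^sup>2))"
    proof -
      have "(\<Sum>j=1..m. g j) \<le> real N * \<Lambda> + real m * (M * h)\<^sup>2"
        using sumRm by (simp add: g_def sum.distrib)
      then have "x * (\<Sum>j=1..m. g j) \<le> x * (real N * \<Lambda> + real m * (M * h)\<^sup>2)"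
        using x by (intro mult_left_mono)
      also have "\<dots> = 2 * K * ((h * real N) * \<Lambda> + (h * real m) * M\<^sup>2 * h\<^sup>2)"
        by (simp add: x_def algebra_simps power_mult_distrib)
      also have "\<dots> \<le> 2 * K * (3 * T * \<Lambda> + T * M\<^sup>2 * h\<^sup>2)"
        unfolding h(2) using K hN \<Lambda>0 by (intro mult_left_mono add_right_mono mult_right_mono) auto
      finally show ?thesis unfolding E_def by (intro mult_left_mono) auto
    qed
    have err: "(L2_norm (\<lambda>z. U k z - u (t k) z))\<^sup>2 \<le> 2 * E + 2 * (R k + R (m + k))" if k: "k \<in> {1..m}" for k
    proof -
      have km: "k \<le> m" "k < N" "m + k < N" using k by (auto simp: N_def)
      obtain gt gr where "C1_per (\<theta> k) gt" "C1_per (\<lambda>z. y k z - w k z) gr"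
        using SC1[OF \<theta>S[OF km(1)]] C1err[OF km(2)] by blast
      from L2_norm_diff_le[OF this]
      have "(L2_norm (\<lambda>z. U k z - u (t k) z))\<^sup>2 \<le> 2 * e k + 2 * R k"
        by (simp add: \<theta>_def e_def R_def yk[OF km(1)])
      then show ?thesis using eE[OF k] R0[OF km(3)] unfolding distrib_left by linarith
    qed
    have "(\<Sum>k=1..m. (L2_norm (\<lambda>z. U k z - u (t k) z))\<^sup>2) \<le> (\<Sum>k=1..m. 2 * E + 2 * (R k + R (m + k)))"
      by (intro sum_mono err)
    also have "\<dots> = real m * (2 * E) + 2 * (\<Sum>k=1..m. R k + R (m + k))"
      by (simp add: sum.distrib sum_distrib_left)
    also have "\<dots> \<le> real m * (2 * E) + 2 * (real N * \<Lambda>)" using sumRm by simp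
    also have "\<dots> \<le> real m * (2 * E + 6 * \<Lambda>)"
    proof -
      \<comment> \<open>The average over the snapshots has the weight \<open>1 / N\<close>, and \<open>N = 2 * m + 1 \<le> 3 * m\<close>.\<close>
      have "real N * \<Lambda> \<le> (3 * real m) * \<Lambda>" using m \<Lambda>0 by (intro mult_right_mono) (auto simp: N_def)
      then show ?thesis by (simp add: algebra_simps)
    qed
    finally have "1 / real m * (\<Sum>k=1..m. (L2_norm (\<lambda>z. U k z - u (t k) z))\<^sup>2) \<le> 2 * E + 6 * \<Lambda>"
      using m by (simp add: pos_divide_le_eq mult.commute)
    also have "\<dots> \<le> C * (h\<^sup>2 + \<Lambda>)"
    proof -
      define c where "c = 4 * K * T * exp (4 * K * T)"
      have c: "0 \<le> c" unfolding c_def using K T by simp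
      have "2 * E \<le> c * (3 * \<Lambda> + M\<^sup>2 * h\<^sup>2)"
        using EC by (simp add: c_def algebra_simps)
      moreover have "C * (h\<^sup>2 + \<Lambda>) = c * (3 * \<Lambda> + M\<^sup>2 * h\<^sup>2) + 6 * \<Lambda> + (3 * c + 6) * h\<^sup>2 + c * M\<^sup>2 * \<Lambda>"
        unfolding C_def c_def[symmetric] by (simp add: algebra_simps)
      moreover have "0 \<le> (3 * c + 6) * h\<^sup>2" "0 \<le> c * M\<^sup>2 * \<Lambda>" using c \<Lambda>0 by auto
      ultimately show ?thesis by linarith
    qed
    finally show ?thesis by (simp add: t_def h_def \<Lambda>_def)
  qed
  then show ?thesis using C \<delta> by (intro exI[of _ C] exI[of _ \<delta>] conjI) auto
qed

end
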